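(* Let $d\ge 1$ and fix $1<b_1<b_2<\infty$ and $c_1,\varepsilon>0$. Then there exist $\alpha>0$ and a set $\mathcal{E}\subset\mathbb{R}^d$, depending on these parameters, such that $\mathcal{L}^d(\mathcal{E})=0$ and the following holds. For every $\boldsymbol{\theta}=(\theta_1,\ldots,\theta_d)\in\mathbb{R}^d\setminus\mathcal{E}$ satisfying $$b_1\le\min_j|\theta_j|<\max_j|\theta_j|\le b_2\quad\text{and}\quad|\theta_i-\theta_j|\ge c_1\ \text{ for all } i\ne j,$$ for every finite digit set $\mathcal{D}=\{a_1,\ldots,a_m\}\subset\mathbb{R}^d$ ($m\ge 2$) such that the iterated function system $\{x\mapsto Ax+a_j\}_{j=1}^m$ with $A=\mathrm{Diag}[\theta_1^{-1},\ldots,\theta_d^{-1}]$ is affinely irreducible, and for every probability vector $\boldsymbol{p}=(p_1,\ldots,p_m)$ with $\min_j p_j\ge\varepsilon$, we have $\mu(\boldsymbol{\theta},\mathcal{D},\boldsymbol{p})\in\mathscr{D}_d(\alpha)$.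
   Context: $\mathcal{L}^d$ is Lebesgue measure on $\mathbb{R}^d$. For a finite positive Borel measure $\nu$ on $\mathbb{R}^d$, $\widehat{\nu}(\xi)=\int_{\mathbb{R}^d}e^{-2\pi i\langle\xi,x\rangle}\,d\nu(x)$. For $\alpha>0$, $\mathscr{D}_d(\alpha)$ is the set of finite positive Borel measures $\nu$ on $\mathbb{R}^d$ such that $|\widehat{\nu}(t)|=O_\nu(|t|^{-\alpha})$ as $|t|\to\infty$ (the implied constant may depend on $\nu$). For $\boldsymbol{\theta}=(\theta_1,\ldots,\theta_d)$ with real entries $|\theta_j|>1$, put $A=\mathrm{Diag}[\theta_1^{-1},\ldots,\theta_d^{-1}]$. For a digit set $\mathcal{D}=\{a_1,\ldots,a_m\}\subset\mathbb{R}^d$, $m\ge2$, and a probability vector $\boldsymbol{p}=(p_1,\ldots,p_m)$, the self-affine measure $\mu=\mu(\boldsymbol{\theta},\mathcal{D},\boldsymbol{p})$ is the unique Borel probability measure on $\mathbb{R}^d$ satisfying $\mu=\sum_{j=1}^m p_j\,(\mu\circ f_j^{-1})$, where $f_j(x)=Ax+a_j$. The iterated function system $\{f_j\}_{j=1}^m$ is affinely irreducible if its attractor $K_{A,\mathcal{D}}=\{\sum_{n=0}^\infty A^n b_n:\ b_n\in\mathcal{D}\}$ is not contained in a proper affine subspace of $\mathbb{R}^d$. *)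

theory Defs
  imports "HOL-Probability.Probability"
begin

definition fourier_transform :: "(real ^ 'n::finite) measure \<Rightarrow> real ^ 'n \<Rightarrow> complex" where
  "fourier_transform \<nu> \<xi> = (LINT x|\<nu>. exp (- 2 * of_real pi * \<i> * of_real (\<xi> \<bullet> x)))"

definition power_decay_measures :: "real \<Rightarrow> (real ^ 'n::finite) measure set" where
  "power_decay_measures \<alpha> =
     {\<nu>. finite_measure \<nu> \<and> sets \<nu> = sets borel \<and>
          (\<lambda>t. norm (fourier_transform \<nu> t)) \<in> O[at_infinity](\<lambda>t. norm t powr (- \<alpha>))}"

definition diag_inverse :: "real ^ 'n::finite \<Rightarrow> real ^ 'n ^ 'n" where
  "diag_inverse \<theta> = (\<chi> i j. if i = j then inverse (\<theta> $ i) else 0)"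

definition ifs_map :: "real ^ 'n::finite \<Rightarrow> (nat \<Rightarrow> real ^ 'n) \<Rightarrow> nat \<Rightarrow> real ^ 'n \<Rightarrow> real ^ 'n" where
  "ifs_map \<theta> a j x = diag_inverse \<theta> *v x + a j"

text \<open>The power of the matrix is written as an iterate of the linear map, since the operation
  \<open>^\<close> on vectors and matrices is not the matrix power. The series converges when
  all entries of \<open>\<theta>\<close> have absolute value greater than one; otherwise the set is not meaningful.\<close>

definition attractor :: "real ^ 'n::finite \<Rightarrow> (real ^ 'n) set \<Rightarrow> (real ^ 'n) set" where
  "attractor \<theta> D = {(\<Sum>n. ((\<lambda>x. diag_inverse \<theta> *v x) ^^ n) (b n)) | b. \<forall>n. b n \<in> D}"

definition affinely_irreducible :: "real ^ 'n::finite \<Rightarrow> (real ^ 'n) set \<Rightarrow> bool" where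
  "affinely_irreducible \<theta> D \<longleftrightarrow> \<not> (\<exists>S. affine S \<and> S \<noteq> UNIV \<and> attractor \<theta> D \<subseteq> S)"

definition probability_vector :: "nat \<Rightarrow> (nat \<Rightarrow> real) \<Rightarrow> bool" where
  "probability_vector m p \<longleftrightarrow> (\<forall>j\<in>{1..m}. 0 \<le> p j) \<and> (\<Sum>j\<in>{1..m}. p j) = 1"

definition is_self_affine_measure ::
  "real ^ 'n::finite \<Rightarrow> nat \<Rightarrow> (nat \<Rightarrow> real ^ 'n) \<Rightarrow> (nat \<Rightarrow> real) \<Rightarrow> (real ^ 'n) measure \<Rightarrow> bool" where
  "is_self_affine_measure \<theta> m a p \<mu> \<longleftrightarrow>
     prob_space \<mu> \<and> sets \<mu> = sets borel \<and>
     (\<forall>B\<in>sets borel. emeasure \<mu> B =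
        (\<Sum>j\<in>{1..m}. ennreal (p j) * emeasure (distr \<mu> borel (ifs_map \<theta> a j)) B))"

definition self_affine_measure ::
  "real ^ 'n::finite \<Rightarrow> nat \<Rightarrow> (nat \<Rightarrow> real ^ 'n) \<Rightarrow> (nat \<Rightarrow> real) \<Rightarrow> (real ^ 'n) measure" where
  "self_affine_measure \<theta> m a p = (THE \<mu>. is_self_affine_measure \<theta> m a p \<mu>)"

end

theory Submission
  imports Defs
begin

text \<open>Write \<open>A\<close> for the contraction with entries \<open>1 / \<theta>\<^sub>l\<close>. Self-affinity factorises the Fourier
transform as a product over \<open>n\<close> of the values \<open>\<phi> (A\<^sup>n \<xi>)\<close>, where \<open>\<phi>\<close> is the weighted sum of the phases
of the digits. A factor is bounded away from 1 in modulus as soon as the inner product of \<open>A\<^sup>n \<xi>\<close> with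
some digit difference stays away from the integers. So power decay follows once a positive
proportion \<open>\<delta>\<close> of the first \<open>N\<close> factors, \<open>N\<close> being comparable to the logarithm of \<open>|\<xi>|\<close>, has this
property.

Choose \<open>N\<close> minimal such that all coordinates of \<open>A\<^sup>N \<xi>\<close> are at most 1; some coordinate \<open>k\<close> is then bounded
below as well. Read backwards from \<open>N\<close>, the inner products are values of an exponential sum
\<open>x\<^sub>n = (\<Sum>l. c\<^sub>l \<theta>\<^sub>l\<^sup>n)\<close> with bounded amplitudes and with \<open>c\<^sub>k\<close> bounded below (irreducibility supplies a digit
difference with nonzero coordinate \<open>k\<close>). A parameter is called resonant at \<open>N\<close> if such a sum is
\<open>\<rho>\<close>-close to an integer for all but \<open>\<delta> N\<close> of the indices \<open>n < N\<close>.

That almost no parameter is resonant for infinitely many \<open>N\<close> is an Erdos--Kahane argument, carried out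
along lines parallel to the axis \<open>k\<close>. On such a line all other \<open>\<theta>\<^sub>l\<close> are known constants, and the
polynomial in the shift operator with these roots annihilates every exponential except that of \<open>\<theta>\<^sub>k\<close>,
whatever its amplitude (\<open>exists_annihilator\<close>). Applied to the nearest integers \<open>K\<^sub>n\<close> of \<open>x\<^sub>n\<close>, it
yields a perturbed geometric sequence \<open>z\<^sub>n\<close>. Hence \<open>z\<^sub>n\<^sub>+\<^sub>1 / z\<^sub>n\<close> determines \<open>\<theta>\<^sub>k\<close> up to an exponentially
small error, while \<open>z\<^sub>n\<^sub>+\<^sub>1\<^sup>2 / z\<^sub>n\<close> predicts the next integer: up to boundedly many choices in
general, uniquely where the \<open>x\<^sub>n\<close> involved are close to integers. The number of sequences \<open>K\<close> therefore grows
so slowly (\<open>card_few_surprises\<close>) that the intervals for \<open>\<theta>\<^sub>k\<close> have summable total length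
(\<open>slow_parameters_cover\<close>). Borel--Cantelli on each line and Tonelli across lines give
\<open>null_resonant_parameters\<close>. The constants \<open>\<rho>\<close> and \<open>\<delta>\<close> come from the dimension and the bounds on \<open>\<theta>\<close> alone; the sizes of the
digits and the separation of the \<open>\<theta>\<^sub>l\<close> enter through a bound \<open>Q\<close>, over which a countable union is taken.

The measure itself is given by a definite description, so its existence (as the law of a random
series) and uniqueness (by contraction on Lipschitz test functions) are established as well.\<close>

section \<open>Counting integer sequences with few surprises\<close>

lemma card_ints_near:
  fixes g R :: real
  assumes "0 \<le> R"
  shows "finite {j::int. \<bar>of_int j - g\<bar> \<le> R}" and "real (card {j::int. \<bar>of_int j - g\<bar> \<le> R}) \<le> 2 * R + 1"
proof -
  have eq: "{j::int. \<bar>of_int j - g\<bar> \<le> R} = {\<lceil>g - R\<rceil>..\<lfloor>g + R\<rfloor>}"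
    by (auto simp: abs_le_iff ceiling_le_iff le_floor_iff)
  show "finite {j::int. \<bar>of_int j - g\<bar> \<le> R}" unfolding eq by simp
  have "real_of_int \<lfloor>g + R\<rfloor> - real_of_int \<lceil>g - R\<rceil> + 1 \<le> 2 * R + 1" by linarith
  then show "real (card {j::int. \<bar>of_int j - g\<bar> \<le> R}) \<le> 2 * R + 1"
    unfolding eq card_atLeastAtMost_int using assms by (cases "0 \<le> \<lfloor>g + R\<rfloor> - \<lceil>g - R\<rceil> + 1") auto
qed

text \<open>The map \<open>G\<close> is a rule that guesses the next entry from the preceding ones. The initial segments
range over \<open>S\<close>, because the rule becomes reliable only after \<open>m\<close> entries.\<close>

definition predictable_lists :: "(int list \<Rightarrow> real) \<Rightarrow> real \<Rightarrow> int list set \<Rightarrow> nat \<Rightarrow> nat \<Rightarrow> int list set" where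
  "predictable_lists G R S m n =
     {xs. length xs = m + n \<and> take m xs \<in> S \<and>
          (\<forall>i. m \<le> i \<longrightarrow> i < m + n \<longrightarrow> \<bar>of_int (xs ! i) - G (take i xs)\<bar> \<le> R)}"

text \<open>Two integers that are both closer than \<open>1/2\<close> to the guess coincide. Away from these positions an
entry is thus determined by its predecessors.\<close>

definition surprises :: "(int list \<Rightarrow> real) \<Rightarrow> nat \<Rightarrow> int list \<Rightarrow> nat set" where
  "surprises G m xs = {i. m \<le> i \<and> i < length xs \<and> 1/2 \<le> \<bar>of_int (xs ! i) - G (take i xs)\<bar>}"

lemma predictable_lists_Suc:
  "predictable_lists G R S m (Suc n) =
     (\<lambda>(xs, j). xs @ [j]) ` Sigma (predictable_lists G R S m n) (\<lambda>xs. {j. \<bar>of_int j - G xs\<bar> \<le> R})"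
  (is "?L = ?R")
proof (intro equalityI subsetI)
  fix ys assume ys: "ys \<in> ?L"
  then have len: "length ys = Suc (m + n)" by (simp add: predictable_lists_def)
  then have split: "ys = take (m + n) ys @ [ys ! (m + n)]"
    by (metis less_add_Suc1 plus_1_eq_Suc take_Suc_conv_app_nth take_all_iff lessI order_refl)
  have "take (m + n) ys \<in> predictable_lists G R S m n"
    using ys len by (auto simp: predictable_lists_def min_def)
  moreover have "\<bar>of_int (ys ! (m + n)) - G (take (m + n) ys)\<bar> \<le> R"
    using ys by (auto simp: predictable_lists_def)
  ultimately show "ys \<in> ?R" using split
    by (intro image_eqI[where x="(take (m + n) ys, ys ! (m + n))"]) auto
next
  fix ys assume "ys \<in> ?R"
  then obtain xs j where "ys = xs @ [j]" "xs \<in> predictable_lists G R S m n" "\<bar>of_int j - G xs\<bar> \<le> R"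
    by auto
  then show "ys \<in> ?L"
    by (auto simp: predictable_lists_def nth_append less_Suc_eq)
qed

lemma card_surprises_snoc:
  assumes "m \<le> length xs"
  shows "card (surprises G m (xs @ [j])) =
     card (surprises G m xs) + (if 1/2 \<le> \<bar>of_int j - G xs\<bar> then 1 else 0)"
proof -
  have fin: "finite (surprises G m xs)" by (auto simp: surprises_def)
  have notin: "length xs \<notin> surprises G m xs" by (auto simp: surprises_def)
  have "surprises G m (xs @ [j]) =
     surprises G m xs \<union> (if 1/2 \<le> \<bar>of_int j - G xs\<bar> then {length xs} else {})"
    using assms by (auto simp: surprises_def nth_append less_Suc_eq split: if_splits)
  then show ?thesis using fin notin by auto
qed

text \<open>At most one candidate is no surprise and has weight 1; the at most \<open>2 * R + 1\<close> others have weight \<open>s\<close>.\<close>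

lemma sum_weight_next_digit:
  fixes g R s :: real
  assumes "0 \<le> R" "0 \<le> s"
  shows "(\<Sum>j\<in>{j::int. \<bar>of_int j - g\<bar> \<le> R}. s ^ (if 1/2 \<le> \<bar>of_int j - g\<bar> then 1 else 0))
          \<le> 1 + (2 * R + 1) * s"
proof -
  let ?J = "{j::int. \<bar>of_int j - g\<bar> \<le> R}"
  let ?A = "{j\<in>?J. 1/2 \<le> \<bar>of_int j - g\<bar>}"
  let ?B = "{j\<in>?J. \<not> 1/2 \<le> \<bar>of_int j - g\<bar>}"
  note fin = card_ints_near(1)[OF assms(1), of g]
  have "(\<Sum>j\<in>?J. s ^ (if 1/2 \<le> \<bar>of_int j - g\<bar> then 1 else 0)) =
        (\<Sum>j\<in>?J. if 1/2 \<le> \<bar>of_int j - g\<bar> then s else 1)"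
    by (rule sum.cong) auto
  also have "\<dots> = real (card ?A) * s + real (card ?B)"
    using fin by (simp add: sum.If_cases Int_def conj_commute)
  also have "\<dots> \<le> (2 * R + 1) * s + 1"
  proof (rule add_mono)
    have "card ?A \<le> card ?J" using fin by (intro card_mono) auto
    then have "real (card ?A) \<le> 2 * R + 1" using card_ints_near(2)[OF assms(1), of g] by linarith
    then show "real (card ?A) * s \<le> (2 * R + 1) * s" using assms(2) by (rule mult_right_mono)
    have "card ?B \<le> Suc 0"
    proof (subst card_le_Suc0_iff_eq)
      show "finite ?B" using fin by simp
      show "\<forall>i\<in>?B. \<forall>j\<in>?B. i = j"
      proof (intro ballI)
        fix i j assume "i \<in> ?B" "j \<in> ?B"
        then have "\<bar>real_of_int i - g\<bar> < 1/2" "\<bar>real_of_int j - g\<bar> < 1/2" by auto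
        then have "\<bar>real_of_int i - real_of_int j\<bar> < 1" by linarith
        then show "i = j" by linarith
      qed
    qed
    then show "real (card ?B) \<le> 1" by simp
  qed
  finally show ?thesis by simp
qed

text \<open>The generating function of the number of surprises is multiplicative along the tree of lists, which
makes it easier to bound than a binomial count of the positions of the surprises.\<close>

lemma sum_weight_predictable_lists:
  fixes R s :: real
  assumes "0 \<le> R" "0 \<le> s" "finite S"
  shows "finite (predictable_lists G R S m n) \<and>
    (\<Sum>xs\<in>predictable_lists G R S m n. s ^ card (surprises G m xs))
      \<le> real (card S) * (1 + (2 * R + 1) * s) ^ n"
proof (induction n)
  case 0
  have sub: "predictable_lists G R S m 0 \<subseteq> S" by (auto simp: predictable_lists_def)
  have "s ^ card (surprises G m xs) = 1" if "xs \<in> predictable_lists G R S m 0" for xs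
  proof -
    have "surprises G m xs = {}" using that by (auto simp: predictable_lists_def surprises_def)
    then show ?thesis by simp
  qed
  then have "(\<Sum>xs\<in>predictable_lists G R S m 0. s ^ card (surprises G m xs)) = real (card (predictable_lists G R S m 0))"
    by simp
  also have "\<dots> \<le> card S" using sub assms(3) by (simp add: card_mono)
  finally show ?case using sub assms(3) finite_subset by auto
next
  case (Suc n)
  let ?T = "predictable_lists G R S m n" and ?J = "\<lambda>xs. {j::int. \<bar>of_int j - G xs\<bar> \<le> R}"
  let ?f = "\<lambda>xs j. s ^ (if 1/2 \<le> \<bar>real_of_int j - G xs\<bar> then 1 else 0)"
  have fin: "finite (Sigma ?T ?J)" using Suc card_ints_near(1)[OF assms(1)] by auto
  have inj: "inj_on (\<lambda>(xs, j). xs @ [j]) (Sigma ?T ?J)" by (auto simp: inj_on_def)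
  have "(\<Sum>xs\<in>predictable_lists G R S m (Suc n). s ^ card (surprises G m xs)) =
      (\<Sum>(xs, j)\<in>Sigma ?T ?J. s ^ card (surprises G m (xs @ [j])))"
    unfolding predictable_lists_Suc by (subst sum.reindex[OF inj]) (simp add: case_prod_unfold)
  also have "\<dots> = (\<Sum>xs\<in>?T. \<Sum>j\<in>?J xs. s ^ card (surprises G m (xs @ [j])))"
    using Suc card_ints_near(1)[OF assms(1)] by (subst sum.Sigma) auto
  also have "\<dots> = (\<Sum>xs\<in>?T. s ^ card (surprises G m xs) * (\<Sum>j\<in>?J xs. ?f xs j))"
    by (intro sum.cong refl, subst sum_distrib_left, intro sum.cong refl)
       (auto simp: predictable_lists_def card_surprises_snoc)
  also have "\<dots> \<le> (\<Sum>xs\<in>?T. s ^ card (surprises G m xs) * (1 + (2 * R + 1) * s))"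
    using assms by (intro sum_mono mult_left_mono sum_weight_next_digit) auto
  also have "\<dots> = (\<Sum>xs\<in>?T. s ^ card (surprises G m xs)) * (1 + (2 * R + 1) * s)"
    by (simp add: sum_distrib_right)
  also have "\<dots> \<le> (real (card S) * (1 + (2 * R + 1) * s) ^ n) * (1 + (2 * R + 1) * s)"
    using Suc assms by (intro mult_right_mono) auto
  finally show ?case using fin by (simp add: predictable_lists_Suc mult_ac)
qed

text \<open>Markov's inequality for the weight \<open>s ^ card (surprises G m xs)\<close>: with few surprises the weight is at
least \<open>s powr v\<close>.\<close>

lemma card_few_surprises:
  fixes R s v :: real and G :: "int list \<Rightarrow> real" and m n :: nat
  assumes "0 \<le> R" "0 < s" "s < 1" "finite S"
  defines "T \<equiv> {xs \<in> predictable_lists G R S m n. real (card (surprises G m xs)) \<le> v}"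
  shows "finite T" and "real (card T) \<le> real (card S) * (1 + (2 * R + 1) * s) ^ n * s powr (- v)"
proof -
  let ?T = "predictable_lists G R S m n"
  have w: "finite ?T" "(\<Sum>xs\<in>?T. s ^ card (surprises G m xs)) \<le> real (card S) * (1 + (2 * R + 1) * s) ^ n"
    using sum_weight_predictable_lists[of R s S G m n] assms by auto
  then show "finite T" by (auto simp: T_def)
  have "real (card T) * s powr v = (\<Sum>xs\<in>T. s powr v)" by simp
  also have "\<dots> \<le> (\<Sum>xs\<in>T. s ^ card (surprises G m xs))"
    using assms(2,3) by (intro sum_mono) (auto simp: T_def powr_realpow[symmetric] powr_mono')
  also have "\<dots> \<le> (\<Sum>xs\<in>?T. s ^ card (surprises G m xs))"
    using w assms by (intro sum_mono2) (auto simp: T_def)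
  also note w(2)
  finally have "real (card T) * s powr v \<le> real (card S) * (1 + (2 * R + 1) * s) ^ n" .
  then show "real (card T) \<le> real (card S) * (1 + (2 * R + 1) * s) ^ n * s powr (- v)"
    using assms(2) by (simp add: powr_minus field_simps)
qed

section \<open>Recovering a ratio from a perturbed geometric sequence\<close>

text \<open>The \<open>q i\<close> are the coefficients of the monic polynomial with roots \<open>f l\<close>; multiplying by a linear
factor with root \<open>f l\<close> increases the sum of the absolute values of the coefficients at most by the factor
\<open>1 + \<bar>f l\<bar>\<close>.\<close>

lemma exists_annihilator:
  fixes f :: "'a \<Rightarrow> real"
  assumes "finite S" "\<And>l. l \<in> S \<Longrightarrow> \<bar>f l\<bar> \<le> b" "0 \<le> b"
  shows "\<exists>q :: nat \<Rightarrow> real. q (card S) = 1 \<and> (\<Sum>i\<le>card S. \<bar>q i\<bar>) \<le> (1 + b) ^ card S \<and>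
           (\<forall>x. (\<Sum>i\<le>card S. q i * x ^ i) = (\<Prod>l\<in>S. x - f l))"
  using assms
proof (induction S)
  case empty
  show ?case by (rule exI[of _ "\<lambda>_. 1"]) auto
next
  case (insert l S)
  then obtain q where q: "q (card S) = 1" "(\<Sum>i\<le>card S. \<bar>q i\<bar>) \<le> (1 + b) ^ card S"
    "\<And>x. (\<Sum>i\<le>card S. q i * x ^ i) = (\<Prod>l\<in>S. x - f l)" by auto
  let ?n = "card S"
  define r where "r = (\<lambda>i. (if i = 0 then 0 else q (i - 1)) - (if i \<le> ?n then f l * q i else 0))"
  have card: "card (insert l S) = Suc ?n" using insert by simp
  have zero: "(\<Sum>i\<le>Suc ?n. if i = 0 then 0 else h (i - 1)) = (\<Sum>i\<le>?n. h i)" for h :: "nat \<Rightarrow> real"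
    by (subst sum.atMost_Suc_shift) simp
  have cut: "(\<Sum>i\<le>Suc ?n. if i \<le> ?n then h i else 0) = (\<Sum>i\<le>?n. h i)" for h :: "nat \<Rightarrow> real"
    by simp
  have "(\<Sum>i\<le>Suc ?n. \<bar>r i\<bar>) \<le> (\<Sum>i\<le>Suc ?n. (if i = 0 then 0 else \<bar>q (i - 1)\<bar>) + (if i \<le> ?n then \<bar>f l\<bar> * \<bar>q i\<bar> else 0))"
    by (rule sum_mono) (auto simp: r_def abs_mult[symmetric])
  also have "\<dots> = (\<Sum>i\<le>?n. \<bar>q i\<bar>) + (\<Sum>i\<le>?n. \<bar>f l\<bar> * \<bar>q i\<bar>)"
    unfolding sum.distrib zero[of "\<lambda>i. \<bar>q i\<bar>"] cut by simp
  also have "\<dots> = (1 + \<bar>f l\<bar>) * (\<Sum>i\<le>?n. \<bar>q i\<bar>)"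
    by (simp add: sum_distrib_left[symmetric] algebra_simps)
  also have "\<dots> \<le> (1 + b) * (1 + b) ^ ?n"
    using insert.prems q(2) by (intro mult_mono sum_nonneg) auto
  finally have r1: "(\<Sum>i\<le>Suc ?n. \<bar>r i\<bar>) \<le> (1 + b) ^ Suc ?n" by simp
  have r2: "(\<Sum>i\<le>Suc ?n. r i * x ^ i) = (\<Prod>l\<in>insert l S. x - f l)" for x
  proof -
    have "(\<Sum>i\<le>Suc ?n. r i * x ^ i) =
       (\<Sum>i\<le>Suc ?n. (if i = 0 then 0 else x * (q (i - 1) * x ^ (i - 1))) - (if i \<le> ?n then f l * (q i * x ^ i) else 0))"
    proof (rule sum.cong[OF refl])
      fix i show "r i * x ^ i = (if i = 0 then 0 else x * (q (i - 1) * x ^ (i - 1))) - (if i \<le> ?n then f l * (q i * x ^ i) else 0)"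
        by (cases i) (auto simp: r_def algebra_simps)
    qed
    also have "\<dots> = (\<Sum>i\<le>?n. x * (q i * x ^ i)) - (\<Sum>i\<le>?n. f l * (q i * x ^ i))"
      unfolding sum_subtractf zero[of "\<lambda>i. x * (q i * x ^ i)"] cut by simp
    also have "\<dots> = (x - f l) * (\<Sum>i\<le>?n. q i * x ^ i)"
      by (simp add: sum_distrib_left[symmetric] algebra_simps)
    finally show ?thesis using insert q(3) by simp
  qed
  have r3: "r (Suc ?n) = 1" using q(1) by (simp add: r_def)
  show ?case unfolding card using r1 r2 r3 by blast
qed

text \<open>This is the polynomial with coefficients \<open>q\<close> in the shift operator. An exponential sequence with ratio \<open>t\<close>
is an eigenvector; its eigenvalue is the value of the polynomial at \<open>t\<close>.\<close>

definition recurrence_op :: "(nat \<Rightarrow> real) \<Rightarrow> nat \<Rightarrow> (nat \<Rightarrow> real) \<Rightarrow> nat \<Rightarrow> real" where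
  "recurrence_op q D x n = (\<Sum>i\<le>D. q i * x (n + i))"

lemma recurrence_op_close:
  assumes "(\<Sum>i\<le>D. \<bar>q i\<bar>) \<le> B" "0 \<le> e" "\<And>i. i \<le> D \<Longrightarrow> \<bar>x (n + i) - w (n + i)\<bar> \<le> e"
  shows "\<bar>recurrence_op q D x n - recurrence_op q D w n\<bar> \<le> B * e"
proof -
  have "recurrence_op q D x n - recurrence_op q D w n = (\<Sum>i\<le>D. q i * (x (n + i) - w (n + i)))"
    by (simp add: recurrence_op_def sum_subtractf algebra_simps)
  also have "\<bar>\<dots>\<bar> \<le> (\<Sum>i\<le>D. \<bar>q i\<bar> * e)"
    by (rule order_trans[OF sum_abs]) (auto simp: abs_mult intro!: sum_mono mult_left_mono assms(3))
  also have "\<dots> \<le> B * e"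
    using assms(1,2) by (simp add: sum_distrib_right[symmetric] mult_right_mono)
  finally show ?thesis .
qed

text \<open>Here \<open>y\<close> is geometric with ratio \<open>\<tau>\<close>, and \<open>z\<close> differs from it by at most \<open>B * e\<close> near the index \<open>n\<close>. As soon as
\<open>y n\<close> dominates the error, the quotient \<open>z (n + 1) / z n\<close> can replace the unknown ratio.\<close>

context
  fixes B b \<tau> C e :: real and y z :: "nat \<Rightarrow> real" and n :: nat
  assumes B: "0 < B" and b: "1 \<le> b" and \<tau>: "\<bar>\<tau>\<bar> \<le> b" and e: "0 \<le> e" "e \<le> 1/2"
    and y: "\<And>i. y i = C * \<tau> ^ i"
    and close: "\<And>i. i \<le> 2 \<Longrightarrow> \<bar>y (n + i) - z (n + i)\<bar> \<le> B * e"
    and large: "2 * B \<le> \<bar>C * \<tau> ^ n\<bar>"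
begin

lemma near_geometric_nonzero: "3/4 * \<bar>C * \<tau> ^ n\<bar> \<le> \<bar>z n\<bar>" "3/2 * B \<le> \<bar>z n\<bar>"
proof -
  have "\<bar>y n - z n\<bar> \<le> B * e" using close[of 0] by simp
  also have "\<dots> \<le> B / 2" using B e by simp
  finally show "3/4 * \<bar>C * \<tau> ^ n\<bar> \<le> \<bar>z n\<bar>" "3/2 * B \<le> \<bar>z n\<bar>" using large y[of n] by linarith+
qed

lemma near_geometric_step:
  assumes "i \<le> 1"
  shows "\<bar>z (n + i + 1) - \<tau> * z (n + i)\<bar> \<le> B * (1 + b) * e"
proof -
  have "z (n + i + 1) - \<tau> * z (n + i) = (z (n + i + 1) - y (n + i + 1)) + \<tau> * (y (n + i) - z (n + i))"
    by (simp add: y algebra_simps)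
  also have "\<bar>\<dots>\<bar> \<le> B * e + b * (B * e)"
    using close[of "i + 1"] close[of i] assms \<tau> b
    by (intro order_trans[OF abs_triangle_ineq] add_mono)
       (auto simp: abs_mult abs_minus_commute intro!: mult_mono)
  finally show ?thesis by (simp add: algebra_simps)
qed

lemma near_geometric_ratio: "\<bar>\<tau> - z (n + 1) / z n\<bar> \<le> B * (1 + b) / \<bar>C * \<tau> ^ n\<bar>"
proof -
  have z: "z n \<noteq> 0" using near_geometric_nonzero(2) B by auto
  have pos: "0 < \<bar>C * \<tau> ^ n\<bar>" using large B by linarith
  have "\<tau> - z (n + 1) / z n = - (z (n + 1) - \<tau> * z n) / z n"
    using z by (simp add: field_simps)
  then have "\<bar>\<tau> - z (n + 1) / z n\<bar> = \<bar>z (n + 1) - \<tau> * z n\<bar> / \<bar>z n\<bar>"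
    by (simp only: abs_divide abs_minus_cancel)
  also have "\<dots> \<le> (B * (1 + b) * (1/2)) / (1/2 * \<bar>C * \<tau> ^ n\<bar>)"
  proof (rule frac_le)
    show "\<bar>z (n + 1) - \<tau> * z n\<bar> \<le> B * (1 + b) * (1/2)"
      using near_geometric_step[of 0] e B b
      by (intro order_trans[OF _ mult_left_mono[OF e(2)]]) auto
    show "1/2 * \<bar>C * \<tau> ^ n\<bar> \<le> \<bar>z n\<bar>" using near_geometric_nonzero(1) pos by linarith
  qed (use pos B b in auto)
  finally show ?thesis by simp
qed

lemma near_geometric_prediction:
  "\<bar>z (n + 2) - (z (n + 1))\<^sup>2 / z n\<bar> \<le> B * (1 + b) * (1 + 2 * b) * e"
proof -
  have z: "z n \<noteq> 0" using near_geometric_nonzero(2) B by auto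
  have pos: "0 < \<bar>C * \<tau> ^ n\<bar>" using large B by linarith
  have "\<bar>\<tau> - z (n + 1) / z n\<bar> \<le> b"
  proof (rule order_trans[OF near_geometric_ratio])
    have "B * (1 + b) / \<bar>C * \<tau> ^ n\<bar> \<le> B * (2 * b) / (2 * B)"
      using large B b by (intro frac_le) auto
    then show "B * (1 + b) / \<bar>C * \<tau> ^ n\<bar> \<le> b" using B by simp
  qed
  then have ratio: "\<bar>z (n + 1) / z n\<bar> \<le> 2 * b" using \<tau> by linarith
  have "z (n + 2) - (z (n + 1))\<^sup>2 / z n =
     (z (n + 2) - \<tau> * z (n + 1)) - (z (n + 1) / z n) * (z (n + 1) - \<tau> * z n)"
    using z by (simp add: field_simps power2_eq_square)
  also have "\<bar>\<dots>\<bar> \<le> B * (1 + b) * e + 2 * b * (B * (1 + b) * e)"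
  proof (rule order_trans[OF abs_triangle_ineq4 add_mono])
    show "\<bar>z (n + 2) - \<tau> * z (n + 1)\<bar> \<le> B * (1 + b) * e" using near_geometric_step[of 1] by simp
    show "\<bar>(z (n + 1) / z n) * (z (n + 1) - \<tau> * z n)\<bar> \<le> 2 * b * (B * (1 + b) * e)"
      unfolding abs_mult using near_geometric_step[of 0] ratio b by (intro mult_mono) auto
  qed
  finally show ?thesis by (simp add: algebra_simps)
qed

end

text \<open>The guess solves \<open>z (n + 2) = (z (n + 1))\<^sup>2 / z n\<close>, an identity for geometric sequences, for the last
entry that \<open>z (n + 2)\<close> involves; this entry carries the leading coefficient \<open>q D = 1\<close>. The index \<open>n\<close> is such
that the missing entry has position \<open>length xs\<close>.\<close>

definition predicted_digit :: "(nat \<Rightarrow> real) \<Rightarrow> nat \<Rightarrow> int list \<Rightarrow> real" where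
  "predicted_digit q D xs =
     (let n = length xs - (D + 2); z = recurrence_op q D (\<lambda>i. of_int (xs ! i))
      in (z (n + 1))\<^sup>2 / z n - (\<Sum>i<D. q i * of_int (xs ! (n + 2 + i))))"

lemma recurrence_op_cong:
  assumes "\<And>i. i \<le> D \<Longrightarrow> x (n + i) = w (n + i)"
  shows "recurrence_op q D x n = recurrence_op q D w n"
  using assms by (simp add: recurrence_op_def)

lemma predicted_digit_prefix:
  fixes k :: "nat \<Rightarrow> int"
  assumes "q D = 1" "i = n + D + 2"
  shows "of_int (k i) - predicted_digit q D (map k [0..<i]) =
     recurrence_op q D (\<lambda>i. of_int (k i)) (n + 2)
       - (recurrence_op q D (\<lambda>i. of_int (k i)) (n + 1))\<^sup>2 / recurrence_op q D (\<lambda>i. of_int (k i)) n"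
proof -
  let ?z = "recurrence_op q D (\<lambda>i. of_int (k i))"
  let ?v = "recurrence_op q D (\<lambda>j. of_int (map k [0..<i] ! j))"
  have nth: "?v j = ?z j" if "j + D < i" for j
    using that by (auto intro!: recurrence_op_cong)
  have v: "?v n = ?z n" "?v (n + 1) = ?z (n + 1)"
    by (rule nth, use assms(2) in simp)+
  have "(\<Sum>j<D. q j * of_int (map k [0..<i] ! (n + 2 + j))) = (\<Sum>j<D. q j * of_int (k (n + 2 + j)))"
  proof (rule sum.cong[OF refl])
    fix j assume "j \<in> {..<D}"
    then have "n + 2 + j < i" using assms(2) by simp
    then show "q j * of_int (map k [0..<i] ! (n + 2 + j)) = q j * of_int (k (n + 2 + j))" by simp
  qed
  moreover have "?z (n + 2) = (\<Sum>j<D. q j * of_int (k (n + 2 + j))) + of_int (k i)"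
    unfolding recurrence_op_def lessThan_Suc_atMost[symmetric] using assms by (simp add: add_ac)
  moreover have "length (map k [0..<i]) - (D + 2) = n" using assms(2) by simp
  ultimately show ?thesis using v by (simp add: predicted_digit_def Let_def)
qed

section \<open>Covering the slow parameters on a line\<close>

definition int_dist :: "real \<Rightarrow> real" where
  "int_dist x = \<bar>x - of_int (round x)\<bar>"

text \<open>The trace on a line of the resonant parameters introduced below: \<open>x\<close> stands for an exponential sum, of which
the recurrence operator retains the single exponential of ratio \<open>\<tau>\<close>. Through the growth bound \<open>H\<close> only finitely
many initial segments of nearest integers can occur.\<close>

definition slow_parameters ::
  "(nat \<Rightarrow> real) \<Rightarrow> nat \<Rightarrow> real \<Rightarrow> real \<Rightarrow> real \<Rightarrow> real \<Rightarrow> real \<Rightarrow> real \<Rightarrow> nat \<Rightarrow> real set" where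
  "slow_parameters q D b1 b2 \<kappa> H \<rho> \<delta> N =
     {\<tau>. b1 \<le> \<bar>\<tau>\<bar> \<and> \<bar>\<tau>\<bar> \<le> b2 \<and>
        (\<exists>x C. \<kappa> \<le> \<bar>C\<bar> \<and> (\<forall>n. recurrence_op q D x n = C * \<tau> ^ n) \<and> (\<forall>n. \<bar>x n\<bar> \<le> H * b2 ^ n) \<and>
           real (card {n. n < N \<and> \<rho> \<le> int_dist (x n)}) \<le> \<delta> * N)}"

text \<open>The centres of the intervals are quotients \<open>z (n + 1) / z n\<close> formed from the possible sequences of nearest
integers. A surprise in such a sequence requires an index with distance more than \<open>\<rho>\<close> from the integers among
the \<open>D + 3\<close> terms that enter the prediction, so there are at most \<open>(D + 3) * \<delta> * N\<close> surprises.\<close>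

lemma slow_parameters_cover:
  fixes q :: "nat \<Rightarrow> real"
  assumes q: "q D = 1" "(\<Sum>i\<le>D. \<bar>q i\<bar>) \<le> B"
    and b: "1 < b1" "b1 \<le> b2" and \<kappa>: "0 < \<kappa>"
    and s: "0 < s" "s < 1"
    and R: "R = B * (1 + b2) * (1 + 2 * b2)" and \<rho>: "0 < \<rho>" "R * \<rho> \<le> 1/4"
  shows "\<exists>m0 K. 0 \<le> K \<and> (\<forall>N\<ge>m0. \<exists>T. finite T \<and>
           real (card T) \<le> K * (1 + (R + 1) * s) ^ N * s powr (- real (D + 3) * \<delta> * N) \<and>
           slow_parameters q D b1 b2 \<kappa> H \<rho> \<delta> N \<subseteq> (\<Union>c\<in>T. cball c (K / b1 ^ N)))"
proof -
  have "1 = \<bar>q D\<bar>" using q by simp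
  also have "\<dots> \<le> (\<Sum>i\<le>D. \<bar>q i\<bar>)" by (rule member_le_sum) auto
  also note q(2)
  finally have B: "1 \<le> B" .
  have "1 * 1 * 1 \<le> R" unfolding R using B b by (intro mult_mono) auto
  then have R1: "1 \<le> R" by simp
  then have \<rho>1: "\<rho> \<le> 1/2" using mult_right_mono[OF R1, of \<rho>] \<rho> by linarith
  \<comment> \<open>From \<open>n0\<close> on, the geometric sequence dominates the rounding error \<open>B / 2\<close>; predictions start \<open>D + 2\<close> later.\<close>
  obtain n0 where n0: "2 * B / \<kappa> < b1 ^ n0" using b(1) real_arch_pow by blast
  define m0 where "m0 = n0 + D + 2"
  \<comment> \<open>All nearest integers before the time \<open>m0\<close> lie in \<open>[-J, J]\<close>.\<close>
  define J where "J = \<lceil>\<bar>H\<bar> * b2 ^ m0 + 1\<rceil>"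
  define S where "S = {xs :: int list. set xs \<subseteq> {-J..J} \<and> length xs = m0}"
  have finS: "finite S" unfolding S_def by (intro finite_lists_length_eq) auto
  define K where "K = max (real (card S)) (B * (1 + b2) / \<kappa> * b1 ^ (D + 2))"
  define G where "G = predicted_digit q D"
  define centre where "centre = (\<lambda>N xs. let n = N - (D + 2); z = recurrence_op q D (\<lambda>i. of_int (xs ! i)) in z (n + 1) / z n)"
  have "\<exists>T. finite T \<and>
           real (card T) \<le> K * (1 + (R + 1) * s) ^ N * s powr (- real (D + 3) * \<delta> * N) \<and>
           slow_parameters q D b1 b2 \<kappa> H \<rho> \<delta> N \<subseteq> (\<Union>c\<in>T. cball c (K / b1 ^ N))" if "m0 \<le> N" for N
  proof -
    define P where "P = {xs \<in> predictable_lists G (R / 2) S m0 (N - m0).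
                            real (card (surprises G m0 xs)) \<le> (D + 3) * \<delta> * N}"
    note cnt = card_few_surprises[of "R / 2" s S G m0 "N - m0" "(D + 3) * \<delta> * N", folded P_def]
    have finP: "finite P" using cnt(1) R1 s finS by simp
    have "real (card P) \<le> real (card S) * (1 + (R + 1) * s) ^ (N - m0) * s powr (- (real (D + 3) * \<delta> * N))"
      using cnt(2) R1 s finS by simp
    also have "\<dots> \<le> K * (1 + (R + 1) * s) ^ N * s powr (- (real (D + 3) * \<delta> * N))"
      using R1 s by (intro mult_right_mono mult_mono power_increasing) (auto simp: K_def)
    finally have cardP: "real (card P) \<le> K * (1 + (R + 1) * s) ^ N * s powr (- real (D + 3) * \<delta> * N)"
      by (simp add: algebra_simps)
    have cover: "\<exists>xs\<in>P. \<tau> \<in> cball (centre N xs) (K / b1 ^ N)"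
      if \<tau>: "\<tau> \<in> slow_parameters q D b1 b2 \<kappa> H \<rho> \<delta> N" for \<tau>
    proof -
      from \<tau> obtain x C where \<tau>b: "b1 \<le> \<bar>\<tau>\<bar>" "\<bar>\<tau>\<bar> \<le> b2" and C: "\<kappa> \<le> \<bar>C\<bar>"
        and rec: "\<And>n. recurrence_op q D x n = C * \<tau> ^ n" and xb: "\<And>n. \<bar>x n\<bar> \<le> H * b2 ^ n"
        and few: "real (card {n. n < N \<and> \<rho> \<le> int_dist (x n)}) \<le> \<delta> * N"
        by (auto simp: slow_parameters_def)
      define k where "k = (\<lambda>i. round (x i))"
      define z where "z = recurrence_op q D (\<lambda>i. of_int (k i))"
      define xs where "xs = map k [0..<N]"
      have Cn: "\<kappa> * b1 ^ n \<le> \<bar>C * \<tau> ^ n\<bar>" for n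
        unfolding abs_mult power_abs using C \<tau>b b \<kappa> by (intro mult_mono power_mono) auto
      have large: "2 * B \<le> \<bar>C * \<tau> ^ n\<bar>" if "n0 \<le> n" for n
      proof -
        have "2 * B \<le> \<kappa> * b1 ^ n0" using n0 \<kappa> by (simp add: field_simps)
        also have "\<dots> \<le> \<kappa> * b1 ^ n" using \<kappa> b that by (intro mult_left_mono power_increasing) auto
        finally show ?thesis using Cn[of n] by linarith
      qed
      have close: "\<bar>C * \<tau> ^ n - z n\<bar> \<le> B * e" if "0 \<le> e" "\<And>i. i \<le> D \<Longrightarrow> int_dist (x (n + i)) \<le> e" for n e
        using recurrence_op_close[of q D B e x n "\<lambda>i. of_int (k i)"] q(2) that
        by (simp add: rec z_def k_def int_dist_def)
      have half: "int_dist t \<le> 1/2" for t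
        using of_int_round_abs_le[of t] by (simp add: int_dist_def abs_minus_commute)
      \<comment> \<open>Used twice: with \<open>e = 1/2\<close> for the general step, with \<open>e = \<rho>\<close> for a step without surprise.\<close>
      have pred: "\<bar>of_int (xs ! i) - G (take i xs)\<bar> \<le> R * e"
        if i: "m0 \<le> i" "i < N" and e: "0 \<le> e" "e \<le> 1/2"
          and small: "\<And>j. j \<le> D + 2 \<Longrightarrow> int_dist (x (i - (D + 2) + j)) \<le> e" for i e
      proof -
        define n where "n = i - (D + 2)"
        have n: "n0 \<le> n" "i = n + D + 2" using i by (auto simp: n_def m0_def)
        have "\<bar>z (n + 2) - (z (n + 1))\<^sup>2 / z n\<bar> \<le> B * (1 + b2) * (1 + 2 * b2) * e"
        proof (rule near_geometric_prediction[where y="\<lambda>i. C * \<tau> ^ i"])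
          fix j :: nat assume "j \<le> 2"
          then show "\<bar>C * \<tau> ^ (n + j) - z (n + j)\<bar> \<le> B * e"
            using small by (intro close e) (simp add: n_def add.assoc)
        qed (use B b \<tau>b e large[OF n(1)] in auto)
        moreover have "xs ! i = k i" "take i xs = map k [0..<i]"
          using i by (auto simp: xs_def take_map)
        ultimately show ?thesis
          unfolding G_def R using predicted_digit_prefix[where q=q and D=D and k=k, OF q(1) n(2)] by (simp add: z_def)
      qed
      have "xs \<in> predictable_lists G (R / 2) S m0 (N - m0)"
        unfolding predictable_lists_def
      proof (intro CollectI conjI allI impI)
        show "length xs = m0 + (N - m0)" using \<open>m0 \<le> N\<close> by (simp add: xs_def)
        have "\<bar>k i\<bar> \<le> J" if "i < m0" for i
        proof -
          have "\<bar>real_of_int (k i)\<bar> \<le> \<bar>x i\<bar> + 1/2"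
            using of_int_round_abs_le[of "x i"] unfolding k_def by linarith
          also have "\<bar>x i\<bar> \<le> \<bar>H\<bar> * b2 ^ i"
            using xb[of i] b by (intro order_trans[OF xb] mult_right_mono) auto
          also have "\<dots> \<le> \<bar>H\<bar> * b2 ^ m0"
            using that b by (intro mult_left_mono power_increasing) auto
          finally have "\<bar>real_of_int (k i)\<bar> \<le> \<bar>H\<bar> * b2 ^ m0 + 1" by simp
          then show ?thesis unfolding J_def by linarith
        qed
        then show "take m0 xs \<in> S"
          using \<open>m0 \<le> N\<close> unfolding S_def xs_def by (force simp: take_map abs_le_iff)
        fix i assume "m0 \<le> i" "i < m0 + (N - m0)"
        then show "\<bar>of_int (xs ! i) - G (take i xs)\<bar> \<le> R / 2"
          using pred[of i "1/2"] half by simp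
      qed
      moreover have "real (card (surprises G m0 xs)) \<le> (D + 3) * \<delta> * N"
      proof -
        let ?F = "{n. n < N \<and> \<rho> \<le> int_dist (x n)}"
        have "surprises G m0 xs \<subseteq> (\<Union>j\<in>{..D + 2}. (+) j ` ?F)"
        proof
          fix i assume "i \<in> surprises G m0 xs"
          then have i: "m0 \<le> i" "i < N" "1/2 \<le> \<bar>of_int (xs ! i) - G (take i xs)\<bar>"
            by (auto simp: surprises_def xs_def)
          then have "\<not> (\<forall>j\<le>D + 2. int_dist (x (i - (D + 2) + j)) \<le> \<rho>)"
            using pred[of i \<rho>] \<rho> \<rho>1 by fastforce
          then obtain j where j: "j \<le> D + 2" "\<rho> < int_dist (x (i - (D + 2) + j))" by force
          then have "i - (D + 2) + j \<in> ?F" "i = (D + 2 - j) + (i - (D + 2) + j)"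
            using i by (auto simp: m0_def)
          then have "i \<in> (+) (D + 2 - j) ` ?F" by (rule image_eqI[rotated])
          then show "i \<in> (\<Union>j\<in>{..D + 2}. (+) j ` ?F)" by (rule UN_I[rotated]) simp
        qed
        then have "card (surprises G m0 xs) \<le> card (\<Union>j\<in>{..D + 2}. (+) j ` ?F)"
          by (rule card_mono[rotated]) (intro finite_UN_I finite_imageI, auto)
        also have "\<dots> \<le> (\<Sum>j\<le>D + 2. card ((+) j ` ?F))" by (rule card_UN_le) auto
        also have "\<dots> = (D + 3) * card ?F" by (simp add: card_image algebra_simps)
        finally have "real (card (surprises G m0 xs)) \<le> real ((D + 3) * card ?F)"
          using of_nat_le_iff by blast
        also have "\<dots> \<le> (D + 3) * (\<delta> * N)"
          unfolding of_nat_mult using few by (intro mult_left_mono) auto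
        finally show ?thesis by (simp add: mult.assoc)
      qed
      ultimately have "xs \<in> P" by (simp add: P_def)
      moreover have "\<tau> \<in> cball (centre N xs) (K / b1 ^ N)"
      proof -
        \<comment> \<open>The last index such that \<open>z n\<close> and \<open>z (n + 1)\<close> involve only entries before \<open>N\<close>.\<close>
        define n where "n = N - (D + 2)"
        have n: "n0 \<le> n" "N = n + (D + 2)" using \<open>m0 \<le> N\<close> by (auto simp: n_def m0_def)
        have eq: "recurrence_op q D (\<lambda>i. of_int (xs ! i)) j = z j" if "j + D < N" for j
          unfolding z_def xs_def using that by (intro recurrence_op_cong) simp
        have "centre N xs = z (n + 1) / z n"
          unfolding centre_def Let_def n_def[symmetric] using n(2) by (simp add: eq)
        moreover have "\<bar>\<tau> - z (n + 1) / z n\<bar> \<le> B * (1 + b2) / \<bar>C * \<tau> ^ n\<bar>"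
        proof (rule near_geometric_ratio[where e="1/2" and y="\<lambda>i. C * \<tau> ^ i"])
          fix j :: nat
          show "\<bar>C * \<tau> ^ (n + j) - z (n + j)\<bar> \<le> B * (1/2)"
            using half by (intro close) auto
        qed (use B b \<tau>b large[OF n(1)] in auto)
        moreover have "B * (1 + b2) / \<bar>C * \<tau> ^ n\<bar> \<le> B * (1 + b2) / (\<kappa> * b1 ^ n)"
          using B b \<kappa> by (intro frac_le Cn) auto
        moreover have "B * (1 + b2) / (\<kappa> * b1 ^ n) = (B * (1 + b2) / \<kappa> * b1 ^ (D + 2)) / b1 ^ N"
          using b \<kappa> by (simp add: n(2) power_add)
        moreover have "\<dots> \<le> K / b1 ^ N" using b by (intro divide_right_mono) (auto simp: K_def)
        ultimately show ?thesis by (simp add: dist_real_def abs_minus_commute)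
      qed
      ultimately show ?thesis by blast
    qed
    have "card (centre N ` P) \<le> card P" using finP by (rule card_image_le)
    then have "real (card (centre N ` P)) \<le> K * (1 + (R + 1) * s) ^ N * s powr (- real (D + 3) * \<delta> * N)"
      using cardP by linarith
    then show ?thesis using finP cover by (intro exI[of _ "centre N ` P"]) blast
  qed
  moreover have "0 \<le> K" by (simp add: K_def)
  ultimately show ?thesis by blast
qed

section \<open>Resonant parameters form a null set\<close>

text \<open>By translation invariance, the measure of \<open>A\<close> equals that of each translate of \<open>A\<close> by a multiple of \<open>v\<close>.
Averaging over the multiples in \<open>[0, 1]\<close> and exchanging the integrals leaves the lengths of the slices,
which vanish.\<close>

lemma null_set_by_line_slices:
  fixes A :: "'a::euclidean_space set"
  assumes A[measurable]: "A \<in> sets borel" and slices: "\<And>x. {t::real. x + t *\<^sub>R v \<in> A} \<in> null_sets lborel"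
  shows "A \<in> null_sets lborel"
proof -
  interpret pair_sigma_finite "lborel :: 'a measure" "lborel :: real measure" ..
  have meas[measurable]: "(\<lambda>(x, t). indicator A (x + t *\<^sub>R v) * indicator {0..1} t :: ennreal)
      \<in> borel_measurable ((lborel :: 'a measure) \<Otimes>\<^sub>M (lborel :: real measure))"
    by measurable
  have "(\<integral>\<^sup>+ t. (\<integral>\<^sup>+ x. indicator A (x + t *\<^sub>R v) * indicator {0..1} t \<partial>lborel) \<partial>lborel) =
        (\<integral>\<^sup>+ x. (\<integral>\<^sup>+ t. indicator A (x + t *\<^sub>R v) * indicator {0..1::real} t \<partial>lborel) \<partial>lborel)"
    by (rule lborel_pair.Fubini') (rule meas)
  also have "\<dots> = (\<integral>\<^sup>+ x. 0 \<partial>(lborel :: 'a measure))"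
  proof (rule nn_integral_cong)
    fix x :: 'a
    have "AE t::real in lborel. t \<notin> {t. x + t *\<^sub>R v \<in> A}" by (rule AE_not_in[OF slices])
    then have "AE t::real in lborel. indicator A (x + t *\<^sub>R v) * indicator {0..1} t = (0::ennreal)"
      by eventually_elim auto
    then have "(\<integral>\<^sup>+ t. indicator A (x + t *\<^sub>R v) * indicator {0..1::real} t \<partial>lborel) = (\<integral>\<^sup>+ t. 0 \<partial>(lborel :: real measure))"
      by (rule nn_integral_cong_AE)
    then show "(\<integral>\<^sup>+ t. indicator A (x + t *\<^sub>R v) * indicator {0..1::real} t \<partial>lborel) = 0" by simp
  qed
  finally have zero: "(\<integral>\<^sup>+ t. (\<integral>\<^sup>+ x. indicator A (x + t *\<^sub>R v) * indicator {0..1} t \<partial>lborel) \<partial>(lborel::real measure)) = 0" by simp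
  have "(\<integral>\<^sup>+ x. indicator A (x + t *\<^sub>R v) * indicator {0..1} t \<partial>lborel) = emeasure lborel A * indicator {0..1} t" for t :: real
  proof -
    have "emeasure lborel A = emeasure (distr lborel borel ((+) (t *\<^sub>R v))) A"
      by (simp add: lborel_distr_plus)
    also have "\<dots> = (\<integral>\<^sup>+ x. indicator A x \<partial>distr lborel borel ((+) (t *\<^sub>R v)))"
      by simp
    also have "\<dots> = (\<integral>\<^sup>+ x. indicator A (t *\<^sub>R v + x) \<partial>lborel)"
      by (subst nn_integral_distr) auto
    finally show ?thesis by (simp add: nn_integral_multc add.commute)
  qed
  then have "(\<integral>\<^sup>+ t. emeasure lborel A * indicator {0..1} t \<partial>(lborel::real measure)) = 0" using zero by simp
  then have "emeasure lborel A = 0" by (simp add: nn_integral_cmult)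
  then show ?thesis by auto
qed

text \<open>The single parameter \<open>Q\<close> controls the separation here and the amplitudes in the definition of resonance
below, so that a countable union over integers \<open>Q\<close> reaches all cases.\<close>

definition separated_box :: "real \<Rightarrow> real \<Rightarrow> real \<Rightarrow> (real ^ 'n::finite) set" where
  "separated_box b1 b2 Q = {\<theta>. (\<forall>l. b1 \<le> \<bar>\<theta> $ l\<bar> \<and> \<bar>\<theta> $ l\<bar> \<le> b2) \<and>
     (\<forall>i j. i \<noteq> j \<longrightarrow> 1 / Q \<le> \<bar>\<theta> $ i - \<theta> $ j\<bar>)}"

definition resonant :: "'n::finite \<Rightarrow> real \<Rightarrow> real \<Rightarrow> real \<Rightarrow> nat \<Rightarrow> (real ^ 'n) set" where
  "resonant k Q \<rho> \<delta> N = {\<theta>. \<exists>c. (\<forall>l. \<bar>c l\<bar> \<le> Q) \<and> 1 / Q \<le> \<bar>c k\<bar> \<and>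
     real (card {n. n < N \<and> \<rho> \<le> int_dist (\<Sum>l\<in>UNIV. c l * (\<theta> $ l) ^ n)}) \<le> \<delta> * N}"

lemma closed_separated_box: "closed (separated_box b1 b2 Q :: (real ^ 'n::finite) set)"
proof -
  have "separated_box b1 b2 Q =
     (\<Inter>l. {\<theta> :: real ^ 'n. b1 \<le> \<bar>\<theta> $ l\<bar>} \<inter> {\<theta>. \<bar>\<theta> $ l\<bar> \<le> b2}) \<inter>
     (\<Inter>i. \<Inter>j\<in>-{i}. {\<theta> :: real ^ 'n. 1 / Q \<le> \<bar>\<theta> $ i - \<theta> $ j\<bar>})"
    by (auto simp: separated_box_def)
  then show ?thesis
    by (auto intro!: closed_INT closed_Int closed_Collect_le continuous_intros)
qed

lemma open_int_dist_less: "open {x. int_dist x < \<rho>}"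
proof -
  have "{x. int_dist x < \<rho>} = (\<Union>j::int. ball (of_int j) \<rho> :: real set)"
  proof (intro equalityI subsetI)
    fix x assume "x \<in> {x. int_dist x < \<rho>}"
    then have "x \<in> ball (of_int (round x))  \<rho>" by (simp add: int_dist_def dist_real_def abs_minus_commute)
    then show "x \<in> (\<Union>j::int. ball (of_int j) \<rho> :: real set)" by blast
  next
    fix x assume "x \<in> (\<Union>j::int. ball (of_int j) \<rho> :: real set)"
    then obtain j :: int where "\<bar>x - of_int j\<bar> < \<rho>" by (auto simp: dist_real_def abs_minus_commute)
    then show "x \<in> {x. int_dist x < \<rho>}" using round_diff_minimal[of x j] by (simp add: int_dist_def)
  qed
  then show ?thesis by (simp add: open_UN)
qed

text \<open>The amplitudes range over an uncountable set, but for fixed amplitudes and a fixed set of exceptional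
indices the condition is open, and arbitrary unions of open sets are open. This is why closeness to the
integers is required with a strict inequality.\<close>

lemma open_resonant: "open (resonant k Q \<rho> \<delta> N)"
proof -
  let ?f = "\<lambda>c n (\<theta> :: real ^ 'a). \<Sum>l\<in>UNIV. c l * (\<theta> $ l) ^ n"
  have eq: "resonant k Q \<rho> \<delta> N =
     (\<Union>c\<in>{c. (\<forall>l. \<bar>c l\<bar> \<le> Q) \<and> 1 / Q \<le> \<bar>c k\<bar>}. \<Union>S\<in>{S. S \<subseteq> {..<N} \<and> real (card S) \<le> \<delta> * N}.
        \<Inter>n\<in>{..<N} - S. ?f c n -` {x. int_dist x < \<rho>})" (is "_ = ?R")
  proof (intro equalityI subsetI)
    fix \<theta> assume "\<theta> \<in> resonant k Q \<rho> \<delta> N"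
    then obtain c where c: "\<forall>l. \<bar>c l\<bar> \<le> Q" "1 / Q \<le> \<bar>c k\<bar>"
      "real (card {n. n < N \<and> \<rho> \<le> int_dist (?f c n \<theta>)}) \<le> \<delta> * N"
      by (auto simp: resonant_def)
    then show "\<theta> \<in> ?R"
      by (intro UN_I[of c] UN_I[of "{n. n < N \<and> \<rho> \<le> int_dist (?f c n \<theta>)}"]) auto
  next
    fix \<theta> assume "\<theta> \<in> ?R"
    then obtain c S where c: "\<forall>l. \<bar>c l\<bar> \<le> Q" "1 / Q \<le> \<bar>c k\<bar>" and S: "S \<subseteq> {..<N}" "real (card S) \<le> \<delta> * N"
      and small: "\<And>n. n < N \<Longrightarrow> n \<notin> S \<Longrightarrow> int_dist (?f c n \<theta>) < \<rho>"
      by auto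
    have "{n. n < N \<and> \<rho> \<le> int_dist (?f c n \<theta>)} \<subseteq> S" using small by force
    then have "card {n. n < N \<and> \<rho> \<le> int_dist (?f c n \<theta>)} \<le> card S"
      using S(1) finite_subset by (intro card_mono) auto
    then show "\<theta> \<in> resonant k Q \<rho> \<delta> N" using c S by (auto simp: resonant_def)
  qed
  have "open (?f c n -` {x. int_dist x < \<rho>})" for c n
    by (intro open_vimage open_int_dist_less continuous_intros)
  then show ?thesis unfolding eq by (intro open_UN ballI open_INT) auto
qed

lemma recurrence_op_exponential_sum:
  fixes f :: "'n::finite \<Rightarrow> real"
  assumes q: "\<And>x. (\<Sum>i\<le>D. q i * x ^ i) = (\<Prod>l\<in>UNIV - {k}. x - f l)"
  shows "recurrence_op q D (\<lambda>n. \<Sum>l\<in>UNIV. c l * (f l) ^ n) n =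
           (c k * (\<Prod>l\<in>UNIV - {k}. f k - f l)) * f k ^ n"
proof -
  have "recurrence_op q D (\<lambda>n. \<Sum>l\<in>UNIV. c l * (f l) ^ n) n =
     (\<Sum>l\<in>UNIV. c l * f l ^ n * (\<Sum>i\<le>D. q i * f l ^ i))"
    unfolding recurrence_op_def sum_distrib_left
    by (subst sum.swap) (simp add: power_add mult_ac)
  also have "\<dots> = (\<Sum>l\<in>UNIV. if l = k then c k * f k ^ n * (\<Prod>l\<in>UNIV - {k}. f k - f l) else 0)"
    by (intro sum.cong refl) (auto simp: q)
  finally show ?thesis by simp
qed

text \<open>Along the line the coordinates other than \<open>k\<close> are constant, hence one recurrence operator serves all of
its points. It multiplies the remaining amplitude by the product of the differences
\<open>\<theta>\<^sub>k - \<theta>\<^sub>l\<close>, which the separation bounds from below.\<close>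

lemma slice_subset_slow_parameters:
  fixes \<theta> :: "real ^ 'n::finite" and k :: 'n and b1 b2 Q \<rho> \<delta> :: real
  assumes b: "1 < b1" "b1 \<le> b2" and Q: "1 \<le> Q" and \<theta>: "\<And>l. l \<noteq> k \<Longrightarrow> \<bar>\<theta> $ l\<bar> \<le> b2"
  defines "D \<equiv> CARD('n) - 1"
  shows "\<exists>q. q D = 1 \<and> (\<Sum>i\<le>D. \<bar>q i\<bar>) \<le> (1 + b2) ^ D \<and>
     (\<forall>t N. \<theta> + t *\<^sub>R axis k 1 \<in> separated_box b1 b2 Q \<inter> resonant k Q \<rho> \<delta> N \<longrightarrow>
        \<theta> $ k + t \<in> slow_parameters q D b1 b2 ((1 / Q) ^ (D + 1)) (CARD('n) * Q) \<rho> \<delta> N)"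
proof -
  have card: "card (UNIV - {k}) = D" by (simp add: D_def card_Diff_singleton)
  obtain q where q: "q D = 1" "(\<Sum>i\<le>D. \<bar>q i\<bar>) \<le> (1 + b2) ^ D"
    "\<And>x. (\<Sum>i\<le>D. q i * x ^ i) = (\<Prod>l\<in>UNIV - {k}. x - \<theta> $ l)"
    using exists_annihilator[of "UNIV - {k}" "($) \<theta>" b2] \<theta> b unfolding card by auto
  have "\<theta> $ k + t \<in> slow_parameters q D b1 b2 ((1 / Q) ^ (D + 1)) (CARD('n) * Q) \<rho> \<delta> N"
    if mem: "\<theta> + t *\<^sub>R axis k 1 \<in> separated_box b1 b2 Q \<inter> resonant k Q \<rho> \<delta> N" for t N
  proof -
    define f where "f = (\<lambda>l. (\<theta> + t *\<^sub>R axis k 1) $ l)"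
    have fl: "f l = \<theta> $ l" if "l \<noteq> k" for l
      using that by (auto simp: f_def axis_def)
    have fk: "f k = \<theta> $ k + t" by (simp add: f_def axis_def)
    from mem obtain c where c: "\<And>l. \<bar>c l\<bar> \<le> Q" "1 / Q \<le> \<bar>c k\<bar>"
      and few: "real (card {n. n < N \<and> \<rho> \<le> int_dist (\<Sum>l\<in>UNIV. c l * f l ^ n)}) \<le> \<delta> * N"
      by (auto simp: resonant_def f_def)
    have fb: "b1 \<le> \<bar>f l\<bar>" "\<bar>f l\<bar> \<le> b2" for l
      using mem by (auto simp: separated_box_def f_def)
    have sep: "1 / Q \<le> \<bar>f k - f l\<bar>" if "l \<noteq> k" for l
      using mem not_sym[OF that] unfolding separated_box_def f_def by blast
    have q': "(\<Sum>i\<le>D. q i * x ^ i) = (\<Prod>l\<in>UNIV - {k}. x - f l)" for x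
      unfolding q(3) by (intro prod.cong) (auto simp: fl)
    have "(1 / Q) * (1 / Q) ^ D \<le> \<bar>c k\<bar> * (\<Prod>l\<in>UNIV - {k}. \<bar>f k - f l\<bar>)"
    proof (rule mult_mono)
      have "(\<Prod>l\<in>UNIV - {k}. 1 / Q) \<le> (\<Prod>l\<in>UNIV - {k}. \<bar>f k - f l\<bar>)"
        using sep Q by (intro prod_mono) auto
      then show "(1 / Q) ^ D \<le> (\<Prod>l\<in>UNIV - {k}. \<bar>f k - f l\<bar>)" by (simp add: card)
    qed (use c Q in auto)
    then have C: "(1 / Q) ^ (D + 1) \<le> \<bar>c k * (\<Prod>l\<in>UNIV - {k}. f k - f l)\<bar>"
      by (simp add: abs_mult abs_prod)
    have x: "\<bar>\<Sum>l\<in>UNIV. c l * f l ^ n\<bar> \<le> CARD('n) * Q * b2 ^ n" for n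
    proof -
      have "\<bar>\<Sum>l\<in>UNIV. c l * f l ^ n\<bar> \<le> (\<Sum>l::'n\<in>UNIV. Q * b2 ^ n)"
        using c fb Q by (intro order_trans[OF sum_abs] sum_mono)
          (auto simp: abs_mult power_abs intro!: mult_mono power_mono)
      then show ?thesis by simp
    qed
    show ?thesis
      unfolding slow_parameters_def fk[symmetric]
      using C x few fb recurrence_op_exponential_sum[where q=q and D=D and f=f and k=k and c=c, OF q'] by blast
  qed
  then show ?thesis using q by blast
qed

text \<open>On each line the slices have lengths bounded by a geometric series: the number of covering intervals grows
more slowly than \<open>b1 ^ N\<close> by the assumption \<open>growth\<close>, while their lengths decay like \<open>1 / b1 ^ N\<close>.\<close>

lemma limsup_resonant_null:
  fixes k :: "'n::finite" and b1 b2 Q R \<rho> \<delta> s :: real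
  assumes b: "1 < b1" "b1 \<le> b2" and Q: "1 \<le> Q"
  defines "D \<equiv> CARD('n) - 1"
  assumes R: "R = (1 + b2) ^ D * (1 + b2) * (1 + 2 * b2)"
    and \<rho>: "0 < \<rho>" "R * \<rho> \<le> 1/4" and s: "0 < s" "s < 1"
    and growth: "(1 + (R + 1) * s) * s powr (- real (D + 3) * \<delta>) < b1"
  shows "limsup (\<lambda>N. separated_box b1 b2 Q \<inter> resonant k Q \<rho> \<delta> N) \<in> null_sets lborel"
proof (rule null_set_by_line_slices[where v = "axis k 1"])
  define A where "A = (\<lambda>N. separated_box b1 b2 Q \<inter> resonant k Q \<rho> \<delta> N)"
  have A[measurable]: "A N \<in> sets borel" for N
    unfolding A_def by (intro sets.Int borel_closed closed_separated_box borel_open open_resonant)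
  show "limsup (\<lambda>N. separated_box b1 b2 Q \<inter> resonant k Q \<rho> \<delta> N) \<in> sets borel"
    unfolding A_def[symmetric] limsup_INF_SUP by (intro sets.countable_INT' sets.countable_UN') auto
  fix \<theta> :: "real ^ 'n"
  define W where "W = (\<lambda>N. {t. \<theta> + t *\<^sub>R axis k 1 \<in> A N})"
  have W[measurable]: "W N \<in> sets lborel" for N
    unfolding W_def by measurable
  have lim: "{t. \<theta> + t *\<^sub>R axis k 1 \<in> limsup A} = limsup W"
    by (auto simp: limsup_INF_SUP W_def)
  have "limsup W \<in> null_sets lborel"
  proof (cases "\<forall>l. l \<noteq> k \<longrightarrow> \<bar>\<theta> $ l\<bar> \<le> b2")
    case False
    then obtain l where l: "l \<noteq> k" "\<not> \<bar>\<theta> $ l\<bar> \<le> b2" by blast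
    have "W N = {}" for N
    proof -
      have "\<theta> + t *\<^sub>R axis k 1 \<notin> separated_box b1 b2 Q" for t
      proof
        assume "\<theta> + t *\<^sub>R axis k 1 \<in> separated_box b1 b2 Q"
        then have "\<bar>(\<theta> + t *\<^sub>R axis k 1) $ l\<bar> \<le> b2" unfolding separated_box_def by blast
        then show False using l by (simp add: axis_def)
      qed
      then show ?thesis by (auto simp: W_def A_def)
    qed
    then show ?thesis by (simp add: limsup_INF_SUP)
  next
    case True
    then obtain q where q: "q D = 1" "(\<Sum>i\<le>D. \<bar>q i\<bar>) \<le> (1 + b2) ^ D"
      and slow: "\<And>t N. t \<in> W N \<Longrightarrow>
        \<theta> $ k + t \<in> slow_parameters q D b1 b2 ((1 / Q) ^ (D + 1)) (CARD('n) * Q) \<rho> \<delta> N"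
      using slice_subset_slow_parameters[OF b Q, of k \<theta> \<rho> \<delta>] unfolding D_def W_def A_def by blast
    have "0 < (1 / Q) ^ (D + 1)" using Q by simp
    from slow_parameters_cover[where q=q and D=D and H="CARD('n) * Q" and \<delta>=\<delta>, OF q b this s R \<rho>]
    obtain m0 K where K: "0 \<le> K" and cover: "\<And>N. m0 \<le> N \<Longrightarrow> \<exists>T. finite T \<and>
           real (card T) \<le> K * (1 + (R + 1) * s) ^ N * s powr (- real (D + 3) * \<delta> * N) \<and>
           slow_parameters q D b1 b2 ((1 / Q) ^ (D + 1)) (CARD('n) * Q) \<rho> \<delta> N \<subseteq> (\<Union>c\<in>T. cball c (K / b1 ^ N))"
      by blast
    define r where "r = (1 + (R + 1) * s) * s powr (- real (D + 3) * \<delta>) / b1"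
    have R0: "0 \<le> R" unfolding R using b by auto
    have r: "0 \<le> r" "r < 1" using growth b R0 s by (auto simp: r_def)
    have fin: "emeasure lborel (W N) < \<infinity>" for N
    proof -
      have "W N \<subseteq> cball (- \<theta> $ k) b2"
      proof
        fix t assume "t \<in> W N"
        then have "\<bar>\<theta> $ k + t\<bar> \<le> b2" using slow by (auto simp: slow_parameters_def)
        then show "t \<in> cball (- \<theta> $ k) b2" by (simp add: dist_real_def)
      qed
      then have "emeasure lborel (W N) \<le> emeasure lborel (cball (- \<theta> $ k) b2)"
        by (rule emeasure_mono) simp
      also have "\<dots> < \<infinity>" by (rule emeasure_bounded_finite[OF bounded_cball])
      finally show ?thesis .
    qed
    have bound: "measure lborel (W N) \<le> 2 * K * K * r ^ N" if N: "m0 \<le> N" for N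
    proof -
      obtain T where T: "finite T" "real (card T) \<le> K * (1 + (R + 1) * s) ^ N * s powr (- real (D + 3) * \<delta> * N)"
        "slow_parameters q D b1 b2 ((1 / Q) ^ (D + 1)) (CARD('n) * Q) \<rho> \<delta> N \<subseteq> (\<Union>c\<in>T. cball c (K / b1 ^ N))"
        using cover[OF N] by blast
      have sub: "W N \<subseteq> (\<Union>c\<in>T. cball (c - \<theta> $ k) (K / b1 ^ N))"
      proof
        fix t assume "t \<in> W N"
        then obtain c where "c \<in> T" "\<theta> $ k + t \<in> cball c (K / b1 ^ N)" using slow T(3) by blast
        then show "t \<in> (\<Union>c\<in>T. cball (c - \<theta> $ k) (K / b1 ^ N))"
          by (intro UN_I[of c]) (auto simp: dist_real_def algebra_simps)
      qed
      have "emeasure lborel (W N) \<le> emeasure lborel (\<Union>c\<in>T. cball (c - \<theta> $ k) (K / b1 ^ N))"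
        using T(1) by (intro emeasure_mono sub sets.finite_UN) auto
      also have "\<dots> \<le> (\<Sum>c\<in>T. emeasure lborel (cball (c - \<theta> $ k) (K / b1 ^ N)))"
        using T(1) by (intro emeasure_subadditive_finite) auto
      also have "\<dots> = (\<Sum>c\<in>T. ennreal (2 * (K / b1 ^ N)))"
        using K b by (intro sum.cong refl) (simp add: cball_eq_atLeastAtMost)
      also have "\<dots> = ennreal (card T * (2 * (K / b1 ^ N)))"
        using K b by (subst ennreal_mult) (auto simp: ennreal_of_nat_eq_real_of_nat)
      finally have "measure lborel (W N) \<le> card T * (2 * (K / b1 ^ N))"
        unfolding measure_def using K b by (intro enn2real_leI) auto
      also have "\<dots> \<le> (K * (1 + (R + 1) * s) ^ N * s powr (- real (D + 3) * \<delta> * N)) * (2 * (K / b1 ^ N))"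
        using T(2) K b by (intro mult_right_mono) auto
      also have "s powr (- real (D + 3) * \<delta> * N) = (s powr (- real (D + 3) * \<delta>)) ^ N"
        using s by (simp add: powr_powr[symmetric] powr_realpow)
      finally show ?thesis by (simp add: r_def power_mult_distrib power_divide mult_ac)
    qed
    show ?thesis
    proof (rule borel_cantelli_limsup1[OF W fin])
      have "summable (\<lambda>N. 2 * K * K * r ^ N)" using r by (intro summable_mult summable_geometric) auto
      then show "summable (\<lambda>N. measure lborel (W N))"
        by (rule summable_comparison_test'[where N = m0]) (use bound in auto)
    qed
  qed
  then show "{t. \<theta> + t *\<^sub>R axis k 1 \<in> limsup (\<lambda>N. separated_box b1 b2 Q \<inter> resonant k Q \<rho> \<delta> N)} \<in> null_sets lborel"
    unfolding lim[symmetric] A_def .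
qed

text \<open>First \<open>s\<close> is chosen so small that the first factor stays below \<open>b\<close>; the second factor tends to 1 as \<open>\<delta>\<close> tends
to 0.\<close>

lemma exists_counting_constants:
  fixes b R :: real and d :: nat
  assumes "1 < b" "0 \<le> R" "0 < d"
  shows "\<exists>\<delta>::real. 0 < \<delta> \<and> (\<exists>s::real. 0 < s \<and> s < 1 \<and> (1 + (R + 1) * s) * s powr (- real d * \<delta>) < b)"
proof -
  define s where "s = min (1/2) ((b - 1) / (2 * (R + 1)))"
  have s: "0 < s" "s < 1" using assms by (auto simp: s_def)
  have "(R + 1) * s \<le> (R + 1) * ((b - 1) / (2 * (R + 1)))"
    using assms by (intro mult_left_mono) (auto simp: s_def)
  also have "\<dots> = (b - 1) / 2" using assms by (simp add: field_simps)
  finally have u: "1 + (R + 1) * s < b" using assms by simp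
  define u where "u = 1 + (R + 1) * s"
  have u0: "0 < u" "u < b" using u assms s by (auto simp: u_def add_pos_nonneg)
  define \<delta> where "\<delta> = ln (b / u) / (2 * d * - ln s)"
  have ls: "ln s < 0" using s by simp
  have lb: "0 < ln (b / u)" using u0 by simp
  have "0 < \<delta>" unfolding \<delta>_def using ls lb assms by (intro divide_pos_pos mult_pos_pos) auto
  moreover have "- real d * \<delta> * ln s = ln (b / u) / 2"
    unfolding \<delta>_def using ls assms by (simp add: field_simps)
  then have "s powr (- real d * \<delta>) = exp (ln (b / u) / 2)" using s by (simp add: powr_def)
  moreover have "\<dots> < exp (ln (b / u))" using lb by simp
  moreover have "exp (ln (b / u)) = b / u" using u0 by simp
  ultimately have "u * s powr (- real d * \<delta>) < b" using u0 by (simp add: field_simps)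
  then show ?thesis using s \<open>0 < \<delta>\<close> unfolding u_def by blast
qed

lemma null_resonant_parameters:
  fixes b1 b2 :: real
  assumes b: "1 < b1" "b1 \<le> b2"
  shows "\<exists>\<rho> \<delta>. 0 < \<rho> \<and> \<rho> < 1/2 \<and> 0 < \<delta> \<and>
     (\<Union>k. \<Union>Q\<in>{1::nat..}. limsup (\<lambda>N. separated_box b1 b2 (real Q) \<inter> resonant k (real Q) \<rho> \<delta> N))
       \<in> null_sets (lborel :: (real ^ 'n::finite) measure)"
proof -
  define D where "D = CARD('n) - 1"
  define R where "R = (1 + b2) ^ D * (1 + b2) * (1 + 2 * b2)"
  have "1 * 1 * 1 \<le> R" unfolding R_def using b by (intro mult_mono one_le_power) auto
  then have R1: "1 \<le> R" by simp
  obtain \<delta> s where d: "0 < \<delta>" "0 < s" "s < 1" "(1 + (R + 1) * s) * s powr (- real (D + 3) * \<delta>) < b1"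
    using exists_counting_constants[of b1 R "D + 3"] b R1 by auto
  define \<rho> where "\<rho> = 1 / (4 * R)"
  have \<rho>: "0 < \<rho>" "R * \<rho> \<le> 1/4" "\<rho> < 1/2" using R1 by (auto simp: \<rho>_def field_simps)
  have "limsup (\<lambda>N. separated_box b1 b2 (real Q) \<inter> resonant k (real Q) \<rho> \<delta> N) \<in> null_sets lborel"
    if "1 \<le> Q" for Q and k :: 'n
    using limsup_resonant_null[OF b, of "real Q" R \<rho> s \<delta> k] that \<rho> d by (simp add: R_def D_def)
  then show ?thesis using \<rho> d
    by (intro exI[where x = \<rho>] exI[where x = \<delta>] conjI null_sets_UN' countableI_type) auto
qed

section \<open>Self-affine measures: existence, uniqueness, irreducibility\<close>

lemma digit_distribution_exists:
  assumes "probability_vector m p"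
  obtains P :: "nat pmf" where "set_pmf P \<subseteq> {1..m}" "\<And>j. j \<in> {1..m} \<Longrightarrow> pmf P j = p j"
proof -
  let ?f = "\<lambda>j. if j \<in> {1..m} then p j else 0"
  have nn: "0 \<le> ?f j" for j using assms by (auto simp: probability_vector_def)
  have "(\<integral>\<^sup>+ j. ennreal (?f j) \<partial>count_space UNIV) = (\<Sum>j\<in>{1..m}. ennreal (p j))"
    by (subst nn_integral_count_space'[of "{1..m}"]) auto
  also have "\<dots> = ennreal (\<Sum>j\<in>{1..m}. p j)"
    using assms by (intro sum_ennreal) (auto simp: probability_vector_def)
  also have "\<dots> = 1" using assms by (simp add: probability_vector_def)
  finally have one: "(\<integral>\<^sup>+ j. ennreal (?f j) \<partial>count_space UNIV) = 1" .
  show ?thesis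
  proof (rule that[of "embed_pmf ?f"])
    show "set_pmf (embed_pmf ?f) \<subseteq> {1..m}" using set_embed_pmf[OF nn one] by auto
    show "pmf (embed_pmf ?f) j = p j" if "j \<in> {1..m}" for j
      using pmf_embed_pmf[OF nn one, of j] that by simp
  qed
qed

lemma diag_inverse_nth: "(diag_inverse \<theta> *v x) $ l = x $ l / \<theta> $ l"
  by (simp add: diag_inverse_def matrix_vector_mult_def if_distrib [where f="\<lambda>c. c * _"] cong: if_cong)
     (simp add: divide_inverse mult.commute)

lemma diag_inverse_funpow_nth: "(((\<lambda>x. diag_inverse \<theta> *v x) ^^ n) x) $ l = x $ l / (\<theta> $ l) ^ n"
  by (induction n) (auto simp: diag_inverse_nth)

lemma norm_diag_inverse_funpow_le:
  assumes "1 < b" "\<And>l. b \<le> \<bar>\<theta> $ l\<bar>"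
  shows "norm (((\<lambda>x. diag_inverse \<theta> *v x) ^^ n) x) \<le> norm x / b ^ n"
proof -
  have "norm (((\<lambda>x. diag_inverse \<theta> *v x) ^^ n) x) \<le> norm ((1 / b ^ n) *\<^sub>R x)"
  proof (rule norm_le_componentwise_cart)
    fix l
    have "\<bar>x $ l\<bar> / \<bar>\<theta> $ l\<bar> ^ n \<le> \<bar>x $ l\<bar> / b ^ n"
      using assms by (intro divide_left_mono power_mono mult_pos_pos zero_less_power)
        (auto intro: less_le_trans[of 0 b] simp del: zero_less_abs_iff)
    then show "norm (((\<lambda>x. diag_inverse \<theta> *v x) ^^ n) x $ l) \<le> norm (((1 / b ^ n) *\<^sub>R x) $ l)"
      using assms(1) by (simp add: diag_inverse_funpow_nth power_abs)
  qed
  then show ?thesis using assms(1) by simp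
qed

lemma continuous_on_ifs_map: "continuous_on S (ifs_map \<theta> a j)"
  unfolding ifs_map_def by (intro continuous_intros)

lemma measurable_ifs_map[measurable]: "ifs_map \<theta> a j \<in> borel_measurable borel"
  by (intro borel_measurable_continuous_onI continuous_on_ifs_map)

lemma dist_ifs_map_le:
  assumes "1 < b" "\<And>l. b \<le> \<bar>\<theta> $ l\<bar>"
  shows "dist (ifs_map \<theta> a j x) (ifs_map \<theta> a j y) \<le> dist x y / b"
  using norm_diag_inverse_funpow_le[OF assms, of 1 "x - y"]
  by (simp add: ifs_map_def dist_norm matrix_vector_mult_diff_distrib)

text \<open>Self-affinity says that the measure is the image of its product with the digit distribution under
the action \<open>(j, x) \<mapsto> f\<^sub>j x\<close>; the formula is then the change of variables together with Fubini.\<close>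

lemma integral_self_affine:
  fixes f :: "real ^ 'n::finite \<Rightarrow> 'b::{banach, second_countable_topology}"
  assumes \<mu>: "is_self_affine_measure \<theta> m a p \<mu>" and p: "probability_vector m p"
    and f[measurable]: "f \<in> borel_measurable borel" and bd: "\<And>x. norm (f x) \<le> M"
  shows "(LINT x|\<mu>. f x) = (\<Sum>j\<in>{1..m}. p j *\<^sub>R (LINT x|\<mu>. f (ifs_map \<theta> a j x)))"
proof -
  interpret \<mu>: prob_space \<mu> using \<mu> by (simp add: is_self_affine_measure_def)
  have sets[measurable_cong]: "sets \<mu> = sets borel" using \<mu> by (simp add: is_self_affine_measure_def)
  have space: "space \<mu> = UNIV" using sets_eq_imp_space_eq[OF sets] by simp
  obtain P where P: "set_pmf P \<subseteq> {1..m}" "\<And>j. j \<in> {1..m} \<Longrightarrow> pmf P j = p j"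
    using digit_distribution_exists[OF p] by blast
  interpret P: pair_prob_space "measure_pmf P" \<mu> ..
  let ?F = "\<lambda>(j, x). ifs_map \<theta> a j x"
  have F[measurable]: "?F \<in> borel_measurable (measure_pmf P \<Otimes>\<^sub>M \<mu>)"
  proof -
    have [measurable]: "(\<lambda>x. diag_inverse \<theta> *v x) \<in> borel_measurable borel"
      by (intro borel_measurable_continuous_onI continuous_intros)
    show ?thesis unfolding ifs_map_def split_beta by measurable
  qed
  have eq: "\<mu> = distr (measure_pmf P \<Otimes>\<^sub>M \<mu>) borel ?F"
  proof (rule measure_eqI)
    fix B assume "B \<in> sets \<mu>"
    then have B[measurable]: "B \<in> sets borel" using sets by simp
    have "emeasure (distr (measure_pmf P \<Otimes>\<^sub>M \<mu>) borel ?F) B =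
        emeasure (measure_pmf P \<Otimes>\<^sub>M \<mu>) (?F -` B \<inter> space (measure_pmf P \<Otimes>\<^sub>M \<mu>))"
      by (simp add: emeasure_distr)
    also have "\<dots> = (\<integral>\<^sup>+ j. emeasure \<mu> (Pair j -` (?F -` B \<inter> space (measure_pmf P \<Otimes>\<^sub>M \<mu>))) \<partial>measure_pmf P)"
      by (rule \<mu>.emeasure_pair_measure_alt) measurable
    also have "\<dots> = (\<integral>\<^sup>+ j. emeasure (distr \<mu> borel (ifs_map \<theta> a j)) B \<partial>measure_pmf P)"
      by (intro nn_integral_cong) (auto simp: emeasure_distr space space_pair_measure intro!: arg_cong2[where f=emeasure])
    also have "\<dots> = (\<Sum>j\<in>{1..m}. emeasure (distr \<mu> borel (ifs_map \<theta> a j)) B * pmf P j)"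
      using P(1) by (intro nn_integral_measure_pmf_support) auto
    also have "\<dots> = emeasure \<mu> B"
      using \<mu> B P(2) by (simp add: is_self_affine_measure_def mult.commute)
    finally show "emeasure \<mu> B = emeasure (distr (measure_pmf P \<Otimes>\<^sub>M \<mu>) borel ?F) B" by simp
  qed (simp add: sets)
  have "(LINT x|\<mu>. f x) = (LINT z|(measure_pmf P \<Otimes>\<^sub>M \<mu>). f (?F z))"
    by (subst eq, subst integral_distr) auto
  also have "\<dots> = (LINT j|measure_pmf P. LINT x|\<mu>. f (?F (j, x)))"
    by (rule P.integral_fst'[symmetric], rule P.integrable_const_bound[where B = M]) (auto simp: bd)
  also have "\<dots> = (\<Sum>j\<in>{1..m}. pmf P j *\<^sub>R (LINT x|\<mu>. f (?F (j, x))))"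
    using P(1) by (intro integral_measure_pmf) auto
  finally show ?thesis using P(2) by simp
qed

text \<open>The measure is the law of the random series \<open>\<Sum>n. A\<^sup>n a\<^bsub>\<omega>\<^sub>n\<^esub>\<close> with independent digits. Splitting
off the first digit of the stream applies one of the maps to the series of the tail.\<close>

lemma self_affine_measure_exists:
  fixes \<theta> :: "real ^ 'n::finite"
  assumes b: "1 < b" "\<And>l. b \<le> \<bar>\<theta> $ l\<bar>" and p: "probability_vector m p"
  shows "\<exists>\<mu>. is_self_affine_measure \<theta> m a p \<mu>"
proof -
  obtain P where P: "set_pmf P \<subseteq> {1..m}" "\<And>j. j \<in> {1..m} \<Longrightarrow> pmf P j = p j"
    using digit_distribution_exists[OF p] by blast
  \<comment> \<open>Digits outside the index range never occur; setting them to 0 makes the series converge for every stream.\<close>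
  define a' where "a' j = (if j \<in> {1..m} then a j else 0)" for j
  define M where "M = (\<Sum>j\<in>{1..m}. norm (a j))"
  have a': "norm (a' j) \<le> M" for j
    unfolding a'_def M_def by (auto intro!: member_le_sum sum_nonneg)
  define A where "A = (\<lambda>x. diag_inverse \<theta> *v x)"
  have A: "bounded_linear A" unfolding A_def by (rule matrix_vector_mul_bounded_linear)
  have Apow[measurable]: "(A ^^ n) \<in> borel_measurable borel" for n
  proof (induction n)
    case (Suc n)
    have [measurable]: "A \<in> borel_measurable borel"
      using A linear_continuous_on borel_measurable_continuous_onI by blast
    show ?case using Suc by (simp add: measurable_comp[of _ borel borel _ borel])
  qed (simp add: id_def)
  define X where "X \<omega> = (\<Sum>n. (A ^^ n) (a' (\<omega> !! n)))" for \<omega> :: "nat stream"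
  let ?S = "stream_space (measure_pmf P)"
  interpret S: prob_space ?S by (rule prob_space.prob_space_stream_space[OF measure_pmf.prob_space_axioms])
  have X[measurable]: "X \<in> borel_measurable ?S" unfolding X_def by measurable
  have summ: "summable (\<lambda>n. (A ^^ n) (a' (\<omega> !! n)))" for \<omega>
  proof (rule summable_comparison_test')
    show "summable (\<lambda>n. M * (1 / b) ^ n)" using b(1) by (intro summable_mult summable_geometric) auto
    show "norm ((A ^^ n) (a' (\<omega> !! n))) \<le> M * (1 / b) ^ n" if "0 \<le> n" for n
    proof -
      have "norm ((A ^^ n) (a' (\<omega> !! n))) \<le> norm (a' (\<omega> !! n)) / b ^ n"
        unfolding A_def by (rule norm_diag_inverse_funpow_le[OF b])
      also have "\<dots> \<le> M / b ^ n" using b(1) by (intro divide_right_mono a') auto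
      finally show ?thesis by (simp add: power_divide)
    qed
  qed
  have X_Stream: "X (j ## \<omega>) = ifs_map \<theta> a' j (X \<omega>)" for j \<omega>
  proof -
    have "X (j ## \<omega>) = (\<Sum>n. (A ^^ Suc n) (a' (\<omega> !! n))) + a' j"
      unfolding X_def using suminf_split_head[OF summ[of "j ## \<omega>"]] by simp
    also have "(\<Sum>n. (A ^^ Suc n) (a' (\<omega> !! n))) = A (X \<omega>)"
      unfolding X_def using bounded_linear.suminf[OF A summ[of \<omega>]] by simp
    finally show ?thesis by (simp add: ifs_map_def A_def)
  qed
  define \<mu> where "\<mu> = distr ?S borel X"
  have "is_self_affine_measure \<theta> m a p \<mu>"
    unfolding is_self_affine_measure_def
  proof (intro conjI ballI)
    show "prob_space \<mu>" unfolding \<mu>_def by (rule S.prob_space_distr) measurable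
    show "sets \<mu> = sets borel" by (simp add: \<mu>_def)
    fix B :: "(real ^ 'n) set" assume B[measurable]: "B \<in> sets borel"
    have "emeasure \<mu> B = (\<integral>\<^sup>+ x. indicator B x \<partial>\<mu>)" using B by (simp add: \<mu>_def)
    also have "\<dots> = (\<integral>\<^sup>+ \<omega>. indicator B (X \<omega>) \<partial>?S)"
      unfolding \<mu>_def by (subst nn_integral_distr) auto
    also have "\<dots> = (\<integral>\<^sup>+ j. (\<integral>\<^sup>+ \<omega>. indicator B (X (j ## \<omega>)) \<partial>?S) \<partial>measure_pmf P)"
      by (rule prob_space.nn_integral_stream_space[OF measure_pmf.prob_space_axioms]) measurable
    also have "\<dots> = (\<integral>\<^sup>+ j. emeasure (distr \<mu> borel (ifs_map \<theta> a' j)) B \<partial>measure_pmf P)"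
    proof (rule nn_integral_cong)
      fix j
      have "emeasure (distr \<mu> borel (ifs_map \<theta> a' j)) B = (\<integral>\<^sup>+ x. indicator B x \<partial>distr \<mu> borel (ifs_map \<theta> a' j))"
        by simp
      also have "\<dots> = (\<integral>\<^sup>+ x. indicator B (ifs_map \<theta> a' j x) \<partial>\<mu>)"
        by (subst nn_integral_distr) (auto simp: \<mu>_def)
      also have "\<dots> = (\<integral>\<^sup>+ \<omega>. indicator B (ifs_map \<theta> a' j (X \<omega>)) \<partial>?S)"
        unfolding \<mu>_def by (subst nn_integral_distr) auto
      finally show "(\<integral>\<^sup>+ \<omega>. indicator B (X (j ## \<omega>)) \<partial>?S) = emeasure (distr \<mu> borel (ifs_map \<theta> a' j)) B"
        by (simp add: X_Stream)
    qed
    also have "\<dots> = (\<Sum>j\<in>{1..m}. emeasure (distr \<mu> borel (ifs_map \<theta> a' j)) B * pmf P j)"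
      using P(1) by (intro nn_integral_measure_pmf_support) auto
    also have "\<dots> = (\<Sum>j\<in>{1..m}. ennreal (p j) * emeasure (distr \<mu> borel (ifs_map \<theta> a j)) B)"
    proof (rule sum.cong[OF refl])
      fix j assume j: "j \<in> {1..m}"
      then have "ifs_map \<theta> a' j = ifs_map \<theta> a j" by (simp add: ifs_map_def a'_def fun_eq_iff)
      then show "emeasure (distr \<mu> borel (ifs_map \<theta> a' j)) B * pmf P j = ennreal (p j) * emeasure (distr \<mu> borel (ifs_map \<theta> a j)) B"
        using P(2)[OF j] by (simp add: mult.commute)
    qed
    finally show "emeasure \<mu> B = (\<Sum>j\<in>{1..m}. ennreal (p j) * emeasure (distr \<mu> borel (ifs_map \<theta> a j)) B)" .
  qed
  then show ?thesis ..
qed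

text \<open>The indicator of a closed set is the decreasing limit of the Lipschitz functions
\<open>max 0 (1 - k * infdist x C)\<close>, and closed sets form an intersection-stable generator.\<close>

lemma measure_eq_if_Lipschitz_integrals_eq:
  fixes \<mu> \<nu> :: "'a::{metric_space, second_countable_topology} measure"
  assumes "prob_space \<mu>" "prob_space \<nu>" and sets: "sets \<mu> = sets borel" "sets \<nu> = sets borel"
    and eq: "\<And>f L. (\<And>x. \<bar>f x\<bar> \<le> 1) \<Longrightarrow> (\<And>x y. \<bar>f x - f y\<bar> \<le> L * dist x y) \<Longrightarrow>
               (LINT x|\<mu>. f x) = (LINT x|\<nu>. (f x :: real))"
  shows "\<mu> = \<nu>"
proof (rule measure_eqI_generator_eq[where \<Omega> = UNIV and E = "Collect closed" and A = "\<lambda>_. UNIV"])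
  interpret \<mu>: prob_space \<mu> by fact
  interpret \<nu>: prob_space \<nu> by fact
  note [measurable_cong] = sets
  have borel: "sets (borel :: 'a measure) = sigma_sets UNIV (Collect closed)"
    by (subst borel_eq_closed) simp
  then show "sets \<mu> = sigma_sets UNIV (Collect closed)" "sets \<nu> = sigma_sets UNIV (Collect closed)"
    using sets by auto
  show "Int_stable (Collect closed :: 'a set set)" by (auto simp: Int_stable_def)
  fix C :: "'a set" assume "C \<in> Collect closed"
  then have C: "closed C" by simp
  show "emeasure \<mu> C = emeasure \<nu> C"
  proof (cases "C = {}")
    case False
    define g where "g k x = max 0 (1 - real k * infdist x C)" for k x
    have g1: "\<bar>g k x\<bar> \<le> 1" for k x by (auto simp: g_def infdist_nonneg)
    have gL: "\<bar>g k x - g k y\<bar> \<le> real k * dist x y" for k x y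
    proof -
      have "\<bar>g k x - g k y\<bar> \<le> \<bar>real k * infdist x C - real k * infdist y C\<bar>"
        by (auto simp: g_def max_def)
      also have "\<dots> = real k * \<bar>infdist x C - infdist y C\<bar>"
        by (simp add: right_diff_distrib[symmetric] abs_mult)
      also have "\<dots> \<le> real k * dist x y" by (intro mult_left_mono infdist_triangle_abs) auto
      finally show ?thesis .
    qed
    have gm[measurable]: "g k \<in> borel_measurable borel" for k
      unfolding g_def by (intro borel_measurable_continuous_onI continuous_intros)
    have lim: "(\<lambda>k. g k x) \<longlonglongrightarrow> indicator C x" for x
    proof (cases "x \<in> C")
      case True
      then have "g k x = 1" for k by (simp add: g_def)
      then show ?thesis using True by simp
    next
      case False
      then have "0 < infdist x C"
        using C \<open>C \<noteq> {}\<close> infdist_nonneg[of x C] by (auto simp: in_closed_iff_infdist_zero less_le)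
      then obtain K :: nat where K: "1 < real K * infdist x C" using reals_Archimedean3 by blast
      have "g k x = 0" if "K \<le> k" for k
      proof -
        have "real K * infdist x C \<le> real k * infdist x C" using that by (intro mult_right_mono) (auto simp: infdist_nonneg)
        then show ?thesis using K by (simp add: g_def)
      qed
      then have "eventually (\<lambda>k. g k x = indicator C x) sequentially"
        using False by (auto simp: eventually_sequentially)
      then show ?thesis by (rule tendsto_eventually)
    qed
    have Cm[measurable]: "C \<in> sets borel" using C by simp
    have "(\<lambda>k. LINT x|\<mu>. g k x) \<longlonglongrightarrow> (LINT x|\<mu>. indicator C x)"
      by (rule integral_dominated_convergence[where w = "\<lambda>_. 1"]) (use g1 lim in auto)
    moreover have "(\<lambda>k. LINT x|\<nu>. g k x) \<longlonglongrightarrow> (LINT x|\<nu>. indicator C x)"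
      by (rule integral_dominated_convergence[where w = "\<lambda>_. 1"]) (use g1 lim in auto)
    moreover have "(LINT x|\<mu>. g k x) = (LINT x|\<nu>. g k x)" for k by (rule eq[OF g1 gL])
    ultimately have "(LINT x|\<mu>. indicator C x) = (LINT x|\<nu>. indicator C x :: real)"
      using LIMSEQ_unique by auto
    then show ?thesis using sets Cm by (simp add: \<mu>.emeasure_eq_measure \<nu>.emeasure_eq_measure)
  qed simp
qed (use assms(1) in \<open>auto simp: prob_space.emeasure_space_1 prob_space.finite_measure finite_measure.emeasure_finite\<close>)

text \<open>Replacing a test function \<open>f\<close> by the average of the \<open>f \<circ> f\<^sub>j\<close> preserves both integrals and divides the
Lipschitz constant by \<open>b\<close>. In the limit the test function is constant, and constants have the same
integral.\<close>

lemma self_affine_measure_unique: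
  fixes \<theta> :: "real ^ 'n::finite"
  assumes b: "1 < b" "\<And>l. b \<le> \<bar>\<theta> $ l\<bar>" and p: "probability_vector m p"
    and \<mu>: "is_self_affine_measure \<theta> m a p \<mu>" and \<nu>: "is_self_affine_measure \<theta> m a p \<nu>"
  shows "\<mu> = \<nu>"
proof -
  have sets[measurable_cong]: "sets \<mu> = sets borel" "sets \<nu> = sets borel"
    using \<mu> \<nu> by (auto simp: is_self_affine_measure_def)
  interpret \<mu>: prob_space \<mu> using \<mu> by (simp add: is_self_affine_measure_def)
  interpret \<nu>: prob_space \<nu> using \<nu> by (simp add: is_self_affine_measure_def)
  \<comment> \<open>A function with Lipschitz constant \<open>\<epsilon>\<close> and values in \<open>[-1, 1]\<close> has integrals for the two measures that differ by at most \<open>h \<epsilon>\<close>.\<close>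
  define h where "h \<epsilon> = (LINT x|\<mu>. min (\<epsilon> * norm x) 2) + (LINT x|\<nu>. min (\<epsilon> * norm x) 2)" for \<epsilon> :: real
  have near0: "\<bar>(LINT x|M. f x) - f 0\<bar> \<le> (LINT x|M. min (L * norm x) 2)"
    if "prob_space M" "sets M = sets borel" "f \<in> borel_measurable borel" "0 \<le> L"
      "\<And>x. \<bar>f x\<bar> \<le> 1" "\<And>x y. \<bar>f x - f y\<bar> \<le> L * dist x y"
    for M and f :: "real ^ 'n \<Rightarrow> real" and L
  proof -
    interpret M: prob_space M by fact
    note [measurable_cong] = that(2)
    note [measurable] = that(3)
    have int: "integrable M f" by (rule M.integrable_const_bound[where B = 1]) (use that in auto)
    have int2: "integrable M (\<lambda>x. min (L * norm x) 2)"
      by (rule M.integrable_const_bound[where B = 2]) (use \<open>0 \<le> L\<close> in auto)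
    have "(LINT x|M. f x) - f 0 = (LINT x|M. f x - f 0)"
      using int by (simp add: M.prob_space)
    also have "\<bar>\<dots>\<bar> \<le> (LINT x|M. \<bar>f x - f 0\<bar>)" by (rule integral_abs_bound)
    also have "\<dots> \<le> (LINT x|M. min (L * norm x) 2)"
    proof (rule integral_mono)
      fix x
      have "\<bar>f x - f 0\<bar> \<le> 2" using that(5)[of x] that(5)[of 0] by linarith
      then show "\<bar>f x - f 0\<bar> \<le> min (L * norm x) 2" using that(6)[of x 0] by simp
    qed (use int int2 in auto)
    finally show ?thesis .
  qed
  have contract: "\<bar>(LINT x|\<mu>. f x) - (LINT x|\<nu>. f x)\<bar> \<le> h (L / b ^ n)"
    if "0 \<le> L" "\<And>x. \<bar>f x\<bar> \<le> 1" "\<And>x y. \<bar>f x - f y\<bar> \<le> L * dist x y" for n f L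
    using that
  proof (induction n arbitrary: f L)
    case 0
    have f: "f \<in> borel_measurable borel"
      using 0 by (intro borel_measurable_continuous_onI lipschitz_on_continuous_on[of L])
        (auto simp: lipschitz_on_def dist_real_def)
    show ?case
      using near0[OF \<mu>.prob_space_axioms sets(1) f 0] near0[OF \<nu>.prob_space_axioms sets(2) f 0]
      by (simp add: h_def)
  next
    case (Suc n)
    have f: "f \<in> borel_measurable borel"
      using Suc.prems by (intro borel_measurable_continuous_onI lipschitz_on_continuous_on[of L])
        (auto simp: lipschitz_on_def dist_real_def)
    let ?I = "\<lambda>M j. LINT x|M. f (ifs_map \<theta> a j x)"
    have "(LINT x|\<mu>. f x) - (LINT x|\<nu>. f x) = (\<Sum>j\<in>{1..m}. p j * (?I \<mu> j - ?I \<nu> j))"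
      using integral_self_affine[OF \<mu> p f, of 1] integral_self_affine[OF \<nu> p f, of 1] Suc.prems(2)
      by (simp add: sum_subtractf right_diff_distrib)
    also have "\<bar>\<dots>\<bar> \<le> (\<Sum>j\<in>{1..m}. p j * h (L / b ^ Suc n))"
    proof (rule order_trans[OF sum_abs sum_mono])
      fix j assume j: "j \<in> {1..m}"
      have "\<bar>?I \<mu> j - ?I \<nu> j\<bar> \<le> h ((L / b) / b ^ n)"
      proof (rule Suc.IH)
        fix x y
        have "\<bar>f (ifs_map \<theta> a j x) - f (ifs_map \<theta> a j y)\<bar> \<le> L * (dist x y / b)"
          using Suc.prems dist_ifs_map_le[OF b] by (meson mult_left_mono order_trans)
        then show "\<bar>f (ifs_map \<theta> a j x) - f (ifs_map \<theta> a j y)\<bar> \<le> L / b * dist x y" by simp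
      qed (use Suc.prems b in auto)
      moreover have "0 \<le> p j" using p j by (simp add: probability_vector_def)
      ultimately show "\<bar>p j * (?I \<mu> j - ?I \<nu> j)\<bar> \<le> p j * h (L / b ^ Suc n)"
        by (simp add: abs_mult mult_left_mono)
    qed
    also have "\<dots> = h (L / b ^ Suc n)"
      using p by (simp add: sum_distrib_right[symmetric] probability_vector_def)
    finally show ?case .
  qed
  have h0: "(\<lambda>n. h (L / b ^ n)) \<longlonglongrightarrow> 0" if "0 \<le> L" for L
  proof -
    have L0: "(\<lambda>n. L / b ^ n) \<longlonglongrightarrow> 0"
      using tendsto_mult_right_zero[OF LIMSEQ_power_zero[of "1 / b"], of L] b by (simp add: power_divide)
    have lim: "(\<lambda>n. min (L / b ^ n * norm x) 2) \<longlonglongrightarrow> 0" for x :: "real ^ 'n"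
      using tendsto_min[OF tendsto_mult_left_zero[OF L0, of "norm x"] tendsto_const[of 2]] by simp
    have bd: "\<bar>min (L / b ^ n * norm x) 2\<bar> \<le> 2" for n and x :: "real ^ 'n"
    proof -
      have "0 \<le> L / b ^ n * norm x" using b that by simp
      then show ?thesis by linarith
    qed
    have "(\<lambda>n. LINT x|\<mu>. min (L / b ^ n * norm x) 2) \<longlonglongrightarrow> (LINT x|\<mu>. 0)"
      by (rule integral_dominated_convergence[where w = "\<lambda>_. 2"]) (use bd lim in auto)
    moreover have "(\<lambda>n. LINT x|\<nu>. min (L / b ^ n * norm x) 2) \<longlonglongrightarrow> (LINT x|\<nu>. 0)"
      by (rule integral_dominated_convergence[where w = "\<lambda>_. 2"]) (use bd lim in auto)
    ultimately show ?thesis unfolding h_def using tendsto_add by fastforce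
  qed
  show ?thesis
  proof (rule measure_eq_if_Lipschitz_integrals_eq)
    fix f :: "real ^ 'n \<Rightarrow> real" and L
    assume f: "\<And>x. \<bar>f x\<bar> \<le> 1" "\<And>x y. \<bar>f x - f y\<bar> \<le> L * dist x y"
    have f': "\<bar>f x - f y\<bar> \<le> max L 0 * dist x y" for x y
      using f(2)[of x y] by (rule order_trans) (auto intro!: mult_right_mono)
    have "\<bar>(LINT x|\<mu>. f x) - (LINT x|\<nu>. f x)\<bar> \<le> 0"
    proof (rule LIMSEQ_le_const[OF h0[of "max L 0"]])
      show "\<exists>N. \<forall>n\<ge>N. \<bar>(LINT x|\<mu>. f x) - (LINT x|\<nu>. f x)\<bar> \<le> h (max L 0 / b ^ n)"
        using contract[of "max L 0" f] f(1) f' by auto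
    qed simp
    then show "(LINT x|\<mu>. f x) = (LINT x|\<nu>. f x)" by simp
  qed (use sets in \<open>auto intro: \<mu>.prob_space_axioms \<nu>.prob_space_axioms\<close>)
qed

lemma self_affine_measure_is_self_affine:
  fixes \<theta> :: "real ^ 'n::finite"
  assumes b: "1 < b" "\<And>l. b \<le> \<bar>\<theta> $ l\<bar>" and p: "probability_vector m p"
  shows "is_self_affine_measure \<theta> m a p (self_affine_measure \<theta> m a p)"
proof -
  obtain \<mu> where \<mu>: "is_self_affine_measure \<theta> m a p \<mu>" using self_affine_measure_exists[OF b p] by blast
  then have "self_affine_measure \<theta> m a p = \<mu>"
    unfolding self_affine_measure_def using self_affine_measure_unique[OF b p] by (intro the_equality)
  then show ?thesis using \<mu> by simp
qed

text \<open>If all digits had the same coordinate \<open>k\<close>, then so would all points of the attractor, and the attractor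
would lie in a hyperplane.\<close>

lemma digit_coordinates_differ:
  fixes \<theta> :: "real ^ 'n::finite" and m :: nat
  assumes b: "1 < b" "\<And>l. b \<le> \<bar>\<theta> $ l\<bar>" and irr: "affinely_irreducible \<theta> (a ` {1..m})" and m: "1 \<le> m"
  shows "\<exists>i\<in>{1..m}. \<exists>j\<in>{1..m}. a i $ k \<noteq> a j $ k"
proof (rule ccontr)
  assume same: "\<not> ?thesis"
  have "1 \<in> {1..m}" using m by simp
  then have const: "a i $ k = a 1 $ k" if "i \<in> {1..m}" for i using that same by blast
  define s where "s = (\<Sum>n. a 1 $ k / (\<theta> $ k) ^ n)"
  let ?S = "{x :: real ^ 'n. x $ k = s}"
  have "?S = {x. axis k 1 \<bullet> x = s}" by (simp add: inner_axis' )
  then have "affine ?S" using affine_hyperplane[of "axis k 1" s] by simp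
  moreover have "?S \<noteq> UNIV"
  proof
    assume "?S = UNIV"
    then have "(\<chi> l. s + 1) \<in> ?S" by blast
    then show False by simp
  qed
  moreover have "attractor \<theta> (a ` {1..m}) \<subseteq> ?S"
  proof
    fix x assume "x \<in> attractor \<theta> (a ` {1..m})"
    then obtain c where x: "x = (\<Sum>n. ((\<lambda>x. diag_inverse \<theta> *v x) ^^ n) (c n))" and c: "\<And>n. c n \<in> a ` {1..m}"
      by (auto simp: attractor_def)
    define M where "M = (\<Sum>j\<in>{1..m}. norm (a j))"
    have M: "norm (c n) \<le> M" for n
      using c[of n] unfolding M_def by (auto intro!: member_le_sum)
    have "summable (\<lambda>n. ((\<lambda>x. diag_inverse \<theta> *v x) ^^ n) (c n))"
    proof (rule summable_comparison_test')
      show "summable (\<lambda>n. M * (1 / b) ^ n)" using b(1) by (intro summable_mult summable_geometric) auto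
      show "norm (((\<lambda>x. diag_inverse \<theta> *v x) ^^ n) (c n)) \<le> M * (1 / b) ^ n" if "0 \<le> n" for n
      proof -
        have "norm (((\<lambda>x. diag_inverse \<theta> *v x) ^^ n) (c n)) \<le> norm (c n) / b ^ n"
          by (rule norm_diag_inverse_funpow_le[OF b])
        also have "\<dots> \<le> M / b ^ n" using b(1) by (intro divide_right_mono M) auto
        finally show ?thesis by (simp add: power_divide)
      qed
    qed
    then have "x $ k = (\<Sum>n. (((\<lambda>x. diag_inverse \<theta> *v x) ^^ n) (c n)) $ k)"
      unfolding x by (rule bounded_linear.suminf[OF bounded_linear_vec_nth])
    also have "\<dots> = s"
    proof -
      have "c n $ k = a 1 $ k" for n
      proof -
        obtain i where "i \<in> {1..m}" "c n = a i" using c[of n] by blast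
        then show ?thesis using const[of i] by simp
      qed
      then show ?thesis by (simp add: diag_inverse_funpow_nth s_def)
    qed
    finally show "x \<in> ?S" by simp
  qed
  ultimately show False using irr unfolding affinely_irreducible_def by blast
qed

section \<open>The product bound for the Fourier transform\<close>

definition unit_phase :: "real \<Rightarrow> complex" where
  "unit_phase t = exp (- 2 * of_real pi * \<i> * of_real t)"

lemma unit_phase_eq_cis: "unit_phase t = cis (- 2 * pi * t)"
  by (simp add: unit_phase_def cis_conv_exp mult_ac)

lemma norm_unit_phase [simp]: "norm (unit_phase t) = 1"
  by (simp add: unit_phase_eq_cis)

lemma unit_phase_add: "unit_phase (s + t) = unit_phase s * unit_phase t"
  by (simp add: unit_phase_eq_cis cis_mult algebra_simps)

lemma continuous_on_unit_phase [continuous_intros]: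
  "continuous_on S f \<Longrightarrow> continuous_on S (\<lambda>x. unit_phase (f x))"
  unfolding unit_phase_def by (intro continuous_intros)

lemma fourier_transform_unit_phase: "fourier_transform \<nu> \<xi> = (LINT x|\<nu>. unit_phase (\<xi> \<bullet> x))"
  by (simp add: fourier_transform_def unit_phase_def)

text \<open>Two unit vectors whose phases differ by \<open>u\<close> have a sum of length \<open>2 * \<bar>cos (pi * u)\<bar>\<close>, and only the
distance of \<open>u\<close> from the integers matters.\<close>

lemma norm_sum_two_phases_le:
  assumes "0 \<le> \<rho>" "\<rho> \<le> 1/2" "\<rho> \<le> int_dist (s - t)"
  shows "norm (unit_phase s + unit_phase t) \<le> 2 * cos (pi * \<rho>)"
proof -
  define u where "u = s - t"
  define v where "v = u - of_int (round u)"
  have v: "\<rho> \<le> \<bar>v\<bar>" "\<bar>v\<bar> \<le> 1/2"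
    using assms(3) of_int_round_abs_le[of u] by (auto simp: int_dist_def u_def v_def abs_minus_commute)
  have "unit_phase u = unit_phase v"
  proof -
    have "unit_phase (of_int (round u)) = 1"
      using cos_int_2pin[of "round u"] sin_int_2pin[of "round u"]
      by (simp add: unit_phase_eq_cis complex_eq_iff mult_ac)
    then show ?thesis using unit_phase_add[of v "of_int (round u)"] by (simp add: v_def)
  qed
  have "unit_phase v = unit_phase (v / 2) * unit_phase (v / 2)" "unit_phase (v/2) * unit_phase (- (v / 2)) = 1"
    using unit_phase_add[of "v/2" "v/2"] unit_phase_add[of "v/2" "- (v/2)"] by (auto simp: unit_phase_eq_cis)
  then have "unit_phase v + 1 = unit_phase (v / 2) * (unit_phase (v / 2) + unit_phase (- (v / 2)))"
    by (simp add: algebra_simps)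
  also have "unit_phase (v / 2) + unit_phase (- (v / 2)) = of_real (2 * cos (pi * v))"
    by (simp add: unit_phase_eq_cis complex_eq_iff)
  finally have "norm (unit_phase v + 1) = 2 * \<bar>cos (pi * v)\<bar>" by (simp add: norm_mult)
  also have "\<dots> = 2 * cos (pi * \<bar>v\<bar>)"
  proof -
    have "pi * \<bar>v\<bar> \<le> pi / 2" using v(2) mult_left_mono[of "\<bar>v\<bar>" "1/2" pi] by simp
    moreover have "- (pi / 2) \<le> pi * \<bar>v\<bar>" by (rule order_trans[of _ 0]) auto
    ultimately have "0 \<le> cos (pi * \<bar>v\<bar>)" by (intro cos_ge_zero)
    moreover have "cos (pi * \<bar>v\<bar>) = cos (pi * v)" by (cases "0 \<le> v") auto
    ultimately show ?thesis by simp
  qed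
  also have "\<dots> \<le> 2 * cos (pi * \<rho>)"
  proof -
    have "pi * \<bar>v\<bar> \<le> pi * 1" using v(2) by (intro mult_left_mono) auto
    moreover have "pi * \<rho> \<le> pi * \<bar>v\<bar>" using v(1) by (intro mult_left_mono) auto
    ultimately show ?thesis using assms(1) by (intro mult_left_mono cos_monotone_0_pi_le) auto
  qed
  finally have "norm (unit_phase v + 1) \<le> 2 * cos (pi * \<rho>)" .
  moreover have "unit_phase s + unit_phase t = unit_phase t * (unit_phase u + 1)"
    using unit_phase_add[of t u] by (simp add: u_def algebra_simps)
  ultimately show ?thesis using \<open>unit_phase u = unit_phase v\<close> by (simp add: norm_mult)
qed

text \<open>From both \<open>p i\<close> and \<open>p j\<close> the same mass \<open>\<epsilon>\<close> is taken out; these two equally weighted phases cancel in part, the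
remaining mass is estimated trivially.\<close>

lemma norm_weighted_phases_le:
  assumes "finite I" "\<And>l. l \<in> I \<Longrightarrow> 0 \<le> p l" "(\<Sum>l\<in>I. p l) = 1"
    and ij: "i \<in> I" "j \<in> I" "i \<noteq> j" and \<epsilon>: "0 \<le> \<epsilon>" "\<epsilon> \<le> p i" "\<epsilon> \<le> p j"
    and \<rho>: "0 \<le> \<rho>" "\<rho> \<le> 1/2" "\<rho> \<le> int_dist (t i - t j)"
  shows "norm (\<Sum>l\<in>I. of_real (p l) * unit_phase (t l)) \<le> 1 - 2 * \<epsilon> * (1 - cos (pi * \<rho>))"
proof -
  define q where "q l = p l - (if l = i \<or> l = j then \<epsilon> else 0)" for l
  have q0: "0 \<le> q l" if "l \<in> I" for l using assms(2)[OF that] \<epsilon> by (auto simp: q_def)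
  have two: "(\<Sum>l\<in>I. if l = i \<or> l = j then f l else 0) = f i + f j" for f :: "'a \<Rightarrow> 'b::comm_monoid_add"
  proof -
    have "(\<Sum>l\<in>I. if l = i \<or> l = j then f l else 0) = sum f ({i, j} \<inter> I)"
      using assms(1) by (auto simp: sum.inter_restrict[symmetric] sum.If_cases intro!: sum.cong)
    also have "{i, j} \<inter> I = {i, j}" using ij by auto
    finally show ?thesis using ij by simp
  qed
  have "(\<Sum>l\<in>I. of_real (p l) * unit_phase (t l)) =
     (\<Sum>l\<in>I. of_real (q l) * unit_phase (t l)) + (\<Sum>l\<in>I. if l = i \<or> l = j then of_real \<epsilon> * unit_phase (t l) else 0)"
    unfolding sum.distrib[symmetric] by (intro sum.cong refl) (auto simp: q_def algebra_simps)
  also have "\<dots> = (\<Sum>l\<in>I. of_real (q l) * unit_phase (t l)) + of_real \<epsilon> * (unit_phase (t i) + unit_phase (t j))"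
    unfolding two by (simp add: algebra_simps)
  also have "norm \<dots> \<le> (\<Sum>l\<in>I. q l) + \<epsilon> * (2 * cos (pi * \<rho>))"
  proof (rule order_trans[OF norm_triangle_ineq add_mono])
    show "norm (\<Sum>l\<in>I. of_real (q l) * unit_phase (t l)) \<le> (\<Sum>l\<in>I. q l)"
      by (rule order_trans[OF norm_sum sum_mono]) (use q0 in \<open>auto simp: norm_mult\<close>)
    show "norm (of_real \<epsilon> * (unit_phase (t i) + unit_phase (t j))) \<le> \<epsilon> * (2 * cos (pi * \<rho>))"
      unfolding norm_mult using \<epsilon>(1) norm_sum_two_phases_le[OF \<rho>] by (intro mult_mono) auto
  qed
  also have "(\<Sum>l\<in>I. q l) = 1 - 2 * \<epsilon>"
    unfolding q_def sum_subtractf two[of "\<lambda>_. \<epsilon>"] assms(3) by simp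
  finally show ?thesis by (simp add: algebra_simps)
qed

text \<open>The maps have a common linear part, which is self-adjoint and moves over to the frequency, while the
translations contribute phases that do not depend on \<open>x\<close>.\<close>

lemma fourier_transform_step:
  fixes \<theta> :: "real ^ 'n::finite"
  assumes \<mu>: "is_self_affine_measure \<theta> m a p \<mu>" and p: "probability_vector m p"
  shows "fourier_transform \<mu> \<xi> =
    (\<Sum>j\<in>{1..m}. of_real (p j) * unit_phase (\<xi> \<bullet> a j)) * fourier_transform \<mu> (diag_inverse \<theta> *v \<xi>)"
proof -
  have sym: "\<xi> \<bullet> (diag_inverse \<theta> *v x) = (diag_inverse \<theta> *v \<xi>) \<bullet> x" for x
    by (simp add: inner_vec_def diag_inverse_nth)
  have "fourier_transform \<mu> \<xi> = (\<Sum>j\<in>{1..m}. p j *\<^sub>R (LINT x|\<mu>. unit_phase (\<xi> \<bullet> ifs_map \<theta> a j x)))"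
    unfolding fourier_transform_unit_phase
    by (rule integral_self_affine[OF \<mu> p, where M = 1])
       (auto intro!: borel_measurable_continuous_onI continuous_intros)
  also have "\<dots> = (\<Sum>j\<in>{1..m}. of_real (p j) * unit_phase (\<xi> \<bullet> a j) * fourier_transform \<mu> (diag_inverse \<theta> *v \<xi>))"
    by (intro sum.cong refl)
       (simp add: ifs_map_def inner_add_right unit_phase_add sym fourier_transform_unit_phase scaleR_conv_of_real mult_ac)
  finally show ?thesis by (simp add: sum_distrib_right)
qed

lemma norm_fourier_transform_le_prod:
  fixes \<theta> :: "real ^ 'n::finite"
  assumes \<mu>: "is_self_affine_measure \<theta> m a p \<mu>" and p: "probability_vector m p"
  defines "A \<equiv> (\<lambda>x. diag_inverse \<theta> *v x)"
  shows "norm (fourier_transform \<mu> \<xi>) \<le>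
    (\<Prod>n<N. norm (\<Sum>j\<in>{1..m}. of_real (p j) * unit_phase ((A ^^ n) \<xi> \<bullet> a j)))"
proof -
  interpret prob_space \<mu> using \<mu> by (simp add: is_self_affine_measure_def)
  let ?\<phi> = "\<lambda>\<xi>. \<Sum>j\<in>{1..m}. of_real (p j) * unit_phase (\<xi> \<bullet> a j)"
  have "norm (fourier_transform \<mu> \<xi>) = (\<Prod>n<N. norm (?\<phi> ((A ^^ n) \<xi>))) * norm (fourier_transform \<mu> ((A ^^ N) \<xi>))"
  proof (induction N)
    case (Suc N)
    then show ?case
      using fourier_transform_step[OF \<mu> p, of "(A ^^ N) \<xi>"] by (simp add: A_def norm_mult)
  qed simp
  also have "\<dots> \<le> (\<Prod>n<N. norm (?\<phi> ((A ^^ n) \<xi>))) * 1"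
  proof (rule mult_left_mono)
    have "norm (fourier_transform \<mu> ((A ^^ N) \<xi>)) \<le> (LINT x|\<mu>. norm (unit_phase ((A ^^ N) \<xi> \<bullet> x)))"
      unfolding fourier_transform_unit_phase by (rule integral_norm_bound)
    then show "norm (fourier_transform \<mu> ((A ^^ N) \<xi>)) \<le> 1" by (simp add: prob_space)
  qed (simp add: prod_nonneg)
  finally show ?thesis by simp
qed

section \<open>Decay for non-resonant parameters\<close>

text \<open>\<open>N\<close> is the first time at which all rescaled coordinates \<open>\<xi>\<^sub>l / \<theta>\<^sub>l\<^sup>N\<close> are at most 1; one step earlier
some coordinate \<open>k\<close> still exceeded 1, so at time \<open>N\<close> it is at least \<open>1 / b2\<close>.\<close>

lemma dominant_coordinate_scale:
  fixes \<theta> \<xi> :: "real ^ 'n::finite" and b1 b2 :: real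
  assumes b: "1 < b1" "\<And>l. b1 \<le> \<bar>\<theta> $ l\<bar>" "\<And>l. \<bar>\<theta> $ l\<bar> \<le> b2"
    and big: "CARD('n) * b2 ^ N0 < norm \<xi>"
  obtains N k where "N0 < N" "norm \<xi> \<le> CARD('n) * b2 ^ N"
    "\<And>l. \<bar>\<xi> $ l\<bar> \<le> \<bar>\<theta> $ l\<bar> ^ N" "\<bar>\<theta> $ k\<bar> ^ N \<le> b2 * \<bar>\<xi> $ k\<bar>"
proof -
  have b2: "1 < b2" using b(1) b(2,3)[of undefined] by linarith
  let ?P = "\<lambda>N. \<forall>l. \<bar>\<xi> $ l\<bar> \<le> \<bar>\<theta> $ l\<bar> ^ N"
  have grow: "norm \<xi> \<le> CARD('n) * b2 ^ N" if "?P N" for N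
  proof -
    have "norm \<xi> \<le> (\<Sum>l\<in>UNIV. \<bar>\<xi> $ l\<bar>)" using norm_le_l1_cart[of \<xi>] by simp
    also have "\<dots> \<le> (\<Sum>l::'n\<in>UNIV. b2 ^ N)"
      using that b(3) by (intro sum_mono) (meson order_trans power_mono abs_ge_zero)
    finally show ?thesis by simp
  qed
  obtain M where M: "norm \<xi> < b1 ^ M" using b(1) real_arch_pow by blast
  have PM: "?P M"
  proof
    fix l
    have "\<bar>\<xi> $ l\<bar> \<le> norm \<xi>" by (rule component_le_norm_cart)
    also have "norm \<xi> \<le> b1 ^ M" using M by simp
    also have "\<dots> \<le> \<bar>\<theta> $ l\<bar> ^ M" using b(1,2) by (intro power_mono) auto
    finally show "\<bar>\<xi> $ l\<bar> \<le> \<bar>\<theta> $ l\<bar> ^ M" .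
  qed
  define N where "N = (LEAST N. ?P N)"
  have PN: "?P N" unfolding N_def using PM by (rule LeastI)
  have "N0 < N"
  proof (rule ccontr)
    assume "\<not> N0 < N"
    then have "CARD('n) * b2 ^ N \<le> CARD('n) * b2 ^ N0"
      using b2 by (intro mult_left_mono power_increasing) auto
    then show False using grow[OF PN] big by linarith
  qed
  then obtain N' where N': "N = Suc N'" by (cases N) auto
  have "\<not> ?P N'" using not_less_Least[of N' ?P] N' unfolding N_def by simp
  then obtain k where k: "\<bar>\<theta> $ k\<bar> ^ N' < \<bar>\<xi> $ k\<bar>" by (meson not_le)
  have "\<bar>\<theta> $ k\<bar> ^ N \<le> b2 * \<bar>\<xi> $ k\<bar>"
    unfolding N' power_Suc using b(3) b2 k by (intro mult_mono) auto
  then show ?thesis using that[of N k] \<open>N0 < N\<close> grow[OF PN] PN by blast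
qed

lemma prod_le_power_card:
  fixes g :: "'a \<Rightarrow> real"
  assumes "finite I" "S \<subseteq> I" "\<And>i. i \<in> I \<Longrightarrow> 0 \<le> g i \<and> g i \<le> 1" "\<And>i. i \<in> S \<Longrightarrow> g i \<le> \<gamma>"
  shows "(\<Prod>i\<in>I. g i) \<le> \<gamma> ^ card S"
proof -
  have "(\<Prod>i\<in>I. g i) \<le> (\<Prod>i\<in>I. if i \<in> S then \<gamma> else 1)"
    using assms by (intro prod_mono) auto
  also have "\<dots> = \<gamma> ^ card S"
    using assms(1,2) by (simp add: prod.If_cases Int_absorb1)
  finally show ?thesis .
qed

text \<open>The amplitudes \<open>c\<close> are the coordinates of \<open>A\<^sup>N \<xi>\<close> times those of a digit difference. The exponential sum
with these amplitudes has at time \<open>n\<close> the value that occurs in the factor with index \<open>N - n\<close>. Since \<open>\<theta>\<close> is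
not resonant at \<open>N\<close>, more than \<open>\<delta> * N\<close> factors are at most \<open>\<gamma>\<close>.\<close>

lemma fourier_decay_off_resonance:
  fixes \<theta> \<xi> :: "real ^ 'n::finite" and a :: "nat \<Rightarrow> real ^ 'n"
    and b1 b2 \<epsilon> \<rho> \<delta> \<gamma> Q :: real
  assumes b: "1 < b1" "\<And>l. b1 \<le> \<bar>\<theta> $ l\<bar>" "\<And>l. \<bar>\<theta> $ l\<bar> \<le> b2"
    and \<mu>: "is_self_affine_measure \<theta> m a p \<mu>" and p: "probability_vector m p"
    and \<epsilon>: "0 < \<epsilon>" "\<And>j. j \<in> {1..m} \<Longrightarrow> \<epsilon> \<le> p j"
    and \<rho>: "0 < \<rho>" "\<rho> < 1/2" and \<delta>: "0 < \<delta>"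
    and IJ: "\<And>k. I k \<in> {1..m}" "\<And>k. J k \<in> {1..m}"
    and Q: "\<And>k l. \<bar>(a (I k) - a (J k)) $ l\<bar> \<le> Q" "\<And>k. b2 / Q \<le> \<bar>(a (I k) - a (J k)) $ k\<bar>" "0 < Q"
    and nonres: "\<And>k N. N0 \<le> N \<Longrightarrow> \<theta> \<notin> resonant k Q \<rho> \<delta> N"
    and \<gamma>: "\<gamma> = 1 - 2 * \<epsilon> * (1 - cos (pi * \<rho>))" "0 < \<gamma>" "\<gamma> < 1"
    and big: "CARD('n) * b2 ^ N0 < norm \<xi>"
  shows "norm (fourier_transform \<mu> \<xi>) \<le> (norm \<xi> / CARD('n)) powr (\<delta> * ln \<gamma> / ln b2)"
proof -
  have b2: "1 < b2" using b(1) b(2,3)[of undefined] by linarith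
  have \<theta>0: "\<theta> $ l \<noteq> 0" for l using b(1) b(2)[of l] by auto
  define A where "A = (\<lambda>x. diag_inverse \<theta> *v x)"
  obtain N k where N: "N0 < N" "norm \<xi> \<le> CARD('n) * b2 ^ N"
    "\<And>l. \<bar>\<xi> $ l\<bar> \<le> \<bar>\<theta> $ l\<bar> ^ N" "\<bar>\<theta> $ k\<bar> ^ N \<le> b2 * \<bar>\<xi> $ k\<bar>"
    using dominant_coordinate_scale[OF b big] by blast
  define \<beta> where "\<beta> = a (I k) - a (J k)"
  define c where "c l = \<beta> $ l * (\<xi> $ l / (\<theta> $ l) ^ N)" for l
  have cQ: "\<bar>c l\<bar> \<le> Q" for l
  proof -
    have "\<bar>\<xi> $ l / (\<theta> $ l) ^ N\<bar> \<le> 1"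
      using N(3)[of l] \<theta>0[of l] by (simp add: abs_divide power_abs)
    then have "\<bar>\<beta> $ l\<bar> * \<bar>\<xi> $ l / (\<theta> $ l) ^ N\<bar> \<le> Q * 1"
      using Q(1)[of k l] Q(3) by (intro mult_mono) (auto simp: \<beta>_def)
    then show ?thesis by (simp add: c_def abs_mult)
  qed
  have ck: "1 / Q \<le> \<bar>c k\<bar>"
  proof -
    have "1 / b2 \<le> \<bar>\<xi> $ k / (\<theta> $ k) ^ N\<bar>"
      using N(4) \<theta>0[of k] b2 by (simp add: abs_divide power_abs field_simps)
    then have "b2 / Q * (1 / b2) \<le> \<bar>\<beta> $ k\<bar> * \<bar>\<xi> $ k / (\<theta> $ k) ^ N\<bar>"
      using Q(2)[of k] Q(3) b2 by (intro mult_mono) (auto simp: \<beta>_def)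
    then show ?thesis using b2 by (simp add: c_def abs_mult)
  qed
  have sum_eq: "(\<Sum>l\<in>UNIV. c l * (\<theta> $ l) ^ n) = (A ^^ (N - n)) \<xi> \<bullet> \<beta>" if "n < N" for n
  proof -
    have "(\<theta> $ l) ^ N = (\<theta> $ l) ^ (N - n) * (\<theta> $ l) ^ n" for l
      using that by (simp add: power_add[symmetric])
    then have "c l * (\<theta> $ l) ^ n = (A ^^ (N - n)) \<xi> $ l * \<beta> $ l" for l
      using \<theta>0[of l] by (simp add: c_def A_def diag_inverse_funpow_nth)
    then show ?thesis by (simp add: inner_vec_def)
  qed
  define F where "F = {n. n < N \<and> \<rho> \<le> int_dist (\<Sum>l\<in>UNIV. c l * (\<theta> $ l) ^ n)}"
  have many: "\<delta> * N < card F"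
    using nonres[of N k] N(1) cQ ck unfolding resonant_def F_def by force
  define S where "S = (\<lambda>n. N - n) ` F"
  have cardS: "card S = card F"
    unfolding S_def by (rule card_image) (auto simp: inj_on_def F_def)
  define g where "g i = norm (\<Sum>j\<in>{1..m}. of_real (p j) * unit_phase ((A ^^ i) \<xi> \<bullet> a j))" for i
  have p0: "\<And>j. j \<in> {1..m} \<Longrightarrow> 0 \<le> p j" "(\<Sum>j\<in>{1..m}. p j) = 1"
    using p by (auto simp: probability_vector_def)
  have g1: "g i \<le> 1" for i
  proof -
    have "g i \<le> (\<Sum>j\<in>{1..m}. p j)"
      unfolding g_def by (rule order_trans[OF norm_sum sum_mono]) (use p0 in \<open>auto simp: norm_mult\<close>)
    then show ?thesis using p0(2) by simp
  qed
  have "0 < b2 / Q" using Q(3) b2 by simp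
  then have \<beta>0: "I k \<noteq> J k" using Q(2)[of k] by auto
  have gS: "g i \<le> \<gamma>" if i: "i \<in> S" for i
  proof -
    obtain n where "n \<in> F" and i: "i = N - n" using i unfolding S_def by (rule imageE)
    then have n: "n < N" "i = N - n" "\<rho> \<le> int_dist (\<Sum>l\<in>UNIV. c l * (\<theta> $ l) ^ n)"
      by (simp_all add: F_def)
    then have far: "\<rho> \<le> int_dist ((A ^^ i) \<xi> \<bullet> a (I k) - (A ^^ i) \<xi> \<bullet> a (J k))"
      using sum_eq[OF n(1)] by (simp add: \<beta>_def inner_diff_right)
    show ?thesis
      unfolding g_def \<gamma>(1)
      using \<rho> \<epsilon>(1)
      by (intro norm_weighted_phases_le[OF _ p0 IJ(1) IJ(2) \<beta>0 _ \<epsilon>(2)[OF IJ(1)] \<epsilon>(2)[OF IJ(2)] _ _ far]) simp_all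
  qed
  have "norm (fourier_transform \<mu> \<xi>) \<le> (\<Prod>i<Suc N. g i)"
    unfolding g_def A_def by (rule norm_fourier_transform_le_prod[OF \<mu> p])
  also have "\<dots> \<le> \<gamma> ^ card S"
    using g1 gS by (intro prod_le_power_card) (auto simp: S_def F_def g_def)
  also have "\<dots> = \<gamma> powr (card F)" using \<gamma> by (simp add: cardS powr_realpow)
  also have "\<dots> \<le> \<gamma> powr (\<delta> * N)" using many \<gamma> by (intro powr_mono') auto
  also have "\<dots> \<le> (norm \<xi> / CARD('n)) powr (\<delta> * ln \<gamma> / ln b2)"
  proof -
    have "0 \<le> CARD('n) * b2 ^ N0" using b2 by simp
    then have "0 < norm \<xi>" using big by linarith
    then have x: "0 < norm \<xi> / CARD('n)" by simp
    have "norm \<xi> / CARD('n) \<le> b2 ^ N" using N(2) by (simp add: field_simps)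
    then have "ln (norm \<xi> / CARD('n)) \<le> ln (b2 ^ N)" using x b2 by (subst ln_le_cancel_iff) auto
    then have "ln (norm \<xi> / CARD('n)) \<le> N * ln b2" using b2 by (simp add: ln_realpow)
    moreover have "\<delta> * ln \<gamma> / ln b2 \<le> 0"
      using \<gamma> \<delta> b2 by (intro divide_nonpos_pos mult_nonneg_nonpos) auto
    ultimately have "\<delta> * ln \<gamma> / ln b2 * (N * ln b2) \<le> \<delta> * ln \<gamma> / ln b2 * ln (norm \<xi> / CARD('n))"
      by (rule mult_left_mono_neg)
    then have "\<delta> * N * ln \<gamma> \<le> \<delta> * ln \<gamma> / ln b2 * ln (norm \<xi> / CARD('n))"
      using b2 by (simp add: mult_ac)
    then show ?thesis using \<gamma> x unfolding powr_def by auto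
  qed
  finally show ?thesis .
qed

lemma eventually_not_resonant:
  fixes \<theta> :: "real ^ 'n::finite"
  assumes "\<theta> \<in> separated_box b1 b2 Q"
    and "\<And>k. \<theta> \<notin> limsup (\<lambda>N. separated_box b1 b2 Q \<inter> resonant k Q \<rho> \<delta> N)"
  shows "\<exists>N0. \<forall>k. \<forall>N\<ge>N0. \<theta> \<notin> resonant k Q \<rho> \<delta> N"
proof -
  have "\<forall>k. \<exists>M. \<forall>N\<ge>M. \<theta> \<notin> resonant k Q \<rho> \<delta> N"
    using assms by (auto simp: limsup_INF_SUP Ball_def)
  then obtain M where M: "\<And>k N. M k \<le> N \<Longrightarrow> \<theta> \<notin> resonant k Q \<rho> \<delta> N" by metis
  have "M k \<le> (\<Sum>k\<in>UNIV. M k)" for k by (rule member_le_sum) auto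
  then show ?thesis using M by (meson order_trans)
qed

theorem theorem1p3:
  fixes b1 b2 c1 \<epsilon> :: real
  assumes "1 < b1" and "b1 < b2" and "0 < c1" and "0 < \<epsilon>"
  shows "\<exists>\<alpha>>0. \<exists>E \<in> null_sets (lebesgue :: (real ^ 'n::finite) measure).
    \<forall>\<theta> :: real ^ 'n. \<theta> \<notin> E \<longrightarrow>
      b1 \<le> Min (range (\<lambda>j. \<bar>\<theta> $ j\<bar>)) \<longrightarrow>
      Min (range (\<lambda>j. \<bar>\<theta> $ j\<bar>)) < Max (range (\<lambda>j. \<bar>\<theta> $ j\<bar>)) \<longrightarrow>
      Max (range (\<lambda>j. \<bar>\<theta> $ j\<bar>)) \<le> b2 \<longrightarrow>
      (\<forall>i j. i \<noteq> j \<longrightarrow> c1 \<le> \<bar>\<theta> $ i - \<theta> $ j\<bar>) \<longrightarrow>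
      (\<forall>(m :: nat) (a :: nat \<Rightarrow> real ^ 'n) (p :: nat \<Rightarrow> real).
         2 \<le> m \<longrightarrow>
         affinely_irreducible \<theta> (a ` {1..m}) \<longrightarrow>
         probability_vector m p \<longrightarrow>
         \<epsilon> \<le> Min (p ` {1..m}) \<longrightarrow>
         self_affine_measure \<theta> m a p \<in> power_decay_measures \<alpha>)"
proof -
  have b2: "1 < b2" using assms by simp
  obtain \<rho> \<delta> where \<rho>: "0 < \<rho>" "\<rho> < 1/2" and \<delta>: "0 < \<delta>"
    and null: "(\<Union>k. \<Union>Q\<in>{1::nat..}. limsup (\<lambda>N. separated_box b1 b2 (real Q) \<inter> resonant k (real Q) \<rho> \<delta> N))
       \<in> null_sets (lborel :: (real ^ 'n) measure)" (is "?E \<in> _")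
    using null_resonant_parameters[of b1 b2] assms by auto
  \<comment> \<open>The truncation keeps \<open>\<gamma>\<close> positive, since \<open>\<alpha>\<close> is chosen before the digits are known.\<close>
  define \<epsilon>' where "\<epsilon>' = min \<epsilon> (1/4)"
  have \<epsilon>': "0 < \<epsilon>'" "\<epsilon>' \<le> \<epsilon>" "\<epsilon>' \<le> 1/4" using assms by (auto simp: \<epsilon>'_def)
  define \<gamma> where "\<gamma> = 1 - 2 * \<epsilon>' * (1 - cos (pi * \<rho>))"
  have \<pi>\<rho>: "0 < pi * \<rho>" "pi * \<rho> < pi / 2"
    using \<rho> mult_strict_left_mono[of \<rho> "1/2" pi] by auto
  have cos: "0 < cos (pi * \<rho>)" "cos (pi * \<rho>) < 1"
    using \<pi>\<rho> cos_monotone_0_pi[of 0 "pi * \<rho>"] by (auto intro!: cos_gt_zero)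
  have "\<epsilon>' * (1 - cos (pi * \<rho>)) \<le> 1/4 * 1" using \<epsilon>' cos by (intro mult_mono) auto
  moreover have "0 < \<epsilon>' * (1 - cos (pi * \<rho>))" using \<epsilon>' cos by simp
  ultimately have \<gamma>: "0 < \<gamma>" "\<gamma> < 1" unfolding \<gamma>_def mult.assoc by linarith+
  define \<alpha> where "\<alpha> = - (\<delta> * ln \<gamma> / ln b2)"
  have \<alpha>: "0 < \<alpha>" unfolding \<alpha>_def using \<delta> \<gamma> b2 by (simp add: divide_neg_pos mult_pos_neg)
  have decay: "self_affine_measure \<theta> m a p \<in> power_decay_measures \<alpha>"
    if \<theta>: "\<theta> \<notin> ?E" "b1 \<le> Min (range (\<lambda>j. \<bar>\<theta> $ j\<bar>))" "Max (range (\<lambda>j. \<bar>\<theta> $ j\<bar>)) \<le> b2"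
      and sep: "\<forall>i j. i \<noteq> j \<longrightarrow> c1 \<le> \<bar>\<theta> $ i - \<theta> $ j\<bar>"
      and m: "2 \<le> m" and irr: "affinely_irreducible \<theta> (a ` {1..m})"
      and p: "probability_vector m p" and p\<epsilon>: "\<epsilon> \<le> Min (p ` {1..m})"
    for \<theta> :: "real ^ 'n" and m a p
  proof -
    define \<mu> where "\<mu> = self_affine_measure \<theta> m a p"
    have \<theta>b: "b1 \<le> \<bar>\<theta> $ l\<bar>" "\<bar>\<theta> $ l\<bar> \<le> b2" for l
      using \<theta>(2,3) by (simp_all add: Min_ge_iff Max_le_iff)
    have \<mu>: "is_self_affine_measure \<theta> m a p \<mu>"
      unfolding \<mu>_def by (rule self_affine_measure_is_self_affine[OF assms(1) \<theta>b(1) p])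
    have "1 \<le> m" using m by simp
    then have "\<forall>k. \<exists>i j. i \<in> {1..m} \<and> j \<in> {1..m} \<and> a i $ k \<noteq> a j $ k"
      using digit_coordinates_differ[OF assms(1) \<theta>b(1) irr] by blast
    then obtain I J where IJ: "\<And>k. I k \<in> {1..m}" "\<And>k. J k \<in> {1..m}" "\<And>k. a (I k) $ k \<noteq> a (J k) $ k"
      by metis
    define \<beta> where "\<beta> k = a (I k) - a (J k)" for k
    have \<beta>k: "0 < \<bar>\<beta> k $ k\<bar>" for k using IJ(3)[of k] by (simp add: \<beta>_def)
    \<comment> \<open>One \<open>Q\<close> that bounds the reciprocal of the separation, the digit differences from above, and their chosen coordinates from below.\<close>
    obtain Q :: nat where Q: "1 + 1 / c1 + (\<Sum>k\<in>UNIV. norm (\<beta> k)) + (\<Sum>k\<in>UNIV. b2 / \<bar>\<beta> k $ k\<bar>) \<le> real Q"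
      using real_arch_simple by blast
    have nn: "0 \<le> 1 / c1" "0 \<le> (\<Sum>k\<in>UNIV. norm (\<beta> k))" "0 \<le> (\<Sum>k\<in>UNIV. b2 / \<bar>\<beta> k $ k\<bar>)"
      using assms by (auto intro!: sum_nonneg)
    have Q1: "1 \<le> real Q" "1 / c1 \<le> real Q" using Q nn by linarith+
    have Q2: "\<bar>\<beta> k $ l\<bar> \<le> real Q" for k l
    proof -
      have "\<bar>\<beta> k $ l\<bar> \<le> norm (\<beta> k)" by (rule component_le_norm_cart)
      also have "\<dots> \<le> (\<Sum>k\<in>UNIV. norm (\<beta> k))" by (rule member_le_sum) auto
      finally show ?thesis using Q nn by linarith
    qed
    have Q3: "b2 / real Q \<le> \<bar>\<beta> k $ k\<bar>" for k
    proof -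
      have "b2 / \<bar>\<beta> k $ k\<bar> \<le> (\<Sum>k\<in>UNIV. b2 / \<bar>\<beta> k $ k\<bar>)" using b2 by (intro member_le_sum) auto
      then have "b2 / \<bar>\<beta> k $ k\<bar> \<le> real Q" using Q nn by linarith
      then show ?thesis using \<beta>k[of k] Q1 by (simp add: field_simps)
    qed
    have box: "\<theta> \<in> separated_box b1 b2 (real Q)"
    proof -
      have "1 / real Q \<le> c1" using Q1 assms(3) by (simp add: field_simps)
      then show ?thesis using \<theta>b sep unfolding separated_box_def by (auto intro: order_trans)
    qed
    have "1 \<le> Q" using Q1 by simp
    then have "\<theta> \<notin> limsup (\<lambda>N. separated_box b1 b2 (real Q) \<inter> resonant k (real Q) \<rho> \<delta> N)" for k
      using \<theta>(1) by blast
    from eventually_not_resonant[OF box this]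
    obtain N0 where N0: "\<And>k N. N0 \<le> N \<Longrightarrow> \<theta> \<notin> resonant k (real Q) \<rho> \<delta> N" by blast
    have p\<epsilon>': "\<epsilon>' \<le> p j" if "j \<in> {1..m}" for j
    proof -
      have "Min (p ` {1..m}) \<le> p j" using that by simp
      then show ?thesis using p\<epsilon> \<epsilon>'(2) by linarith
    qed
    have fourier_le: "norm (fourier_transform \<mu> \<xi>) \<le> (norm \<xi> / CARD('n)) powr (- \<alpha>)"
      if big: "CARD('n) * b2 ^ N0 < norm \<xi>" for \<xi>
    proof -
      have "- \<alpha> = \<delta> * ln \<gamma> / ln b2" by (simp add: \<alpha>_def)
      moreover have "norm (fourier_transform \<mu> \<xi>) \<le> (norm \<xi> / CARD('n)) powr (\<delta> * ln \<gamma> / ln b2)"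
      proof (rule fourier_decay_off_resonance[where I = I and J = J and \<gamma> = \<gamma> and Q = "real Q" and ?N0.0 = N0 and \<epsilon> = \<epsilon>' and \<rho> = \<rho>])
        show "0 < real Q" using Q1 by simp
        show "\<bar>(a (I k) - a (J k)) $ l\<bar> \<le> real Q" for k l using Q2[of k l] by (simp only: \<beta>_def)
        show "b2 / real Q \<le> \<bar>(a (I k) - a (J k)) $ k\<bar>" for k using Q3[of k] by (simp only: \<beta>_def)
      qed (fact assms(1) \<theta>b \<mu> p \<epsilon>'(1) p\<epsilon>' \<rho> \<delta> IJ(1,2) N0 \<gamma>_def \<gamma> big)+
      ultimately show ?thesis by simp
    qed
    have "(\<lambda>t. norm (fourier_transform \<mu> t)) \<in> O[at_infinity](\<lambda>t. norm t powr (- \<alpha>))"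
    proof (rule bigoI)
      show "eventually (\<lambda>t. norm (norm (fourier_transform \<mu> t)) \<le> CARD('n) powr \<alpha> * norm (norm t powr (- \<alpha>))) at_infinity"
        unfolding eventually_at_infinity
      proof (intro exI allI impI)
        fix t :: "real ^ 'n" assume t: "CARD('n) * b2 ^ N0 + 1 \<le> norm t"
        have "(norm t / CARD('n)) powr (- \<alpha>) = norm t powr (- \<alpha>) / CARD('n) powr (- \<alpha>)"
          by (rule powr_divide)
        also have "\<dots> = CARD('n) powr \<alpha> * norm t powr (- \<alpha>)"
          unfolding powr_minus[of "real CARD('n)" \<alpha>] divide_inverse inverse_inverse_eq by (rule mult.commute)
        finally have "(norm t / CARD('n)) powr (- \<alpha>) = CARD('n) powr \<alpha> * norm t powr (- \<alpha>)" .
        then show "norm (norm (fourier_transform \<mu> t)) \<le> CARD('n) powr \<alpha> * norm (norm t powr (- \<alpha>))"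
          using fourier_le[of t] t by (simp add: abs_of_nonneg)
      qed
    qed
    moreover have "finite_measure \<mu>" "sets \<mu> = sets borel"
      using \<mu> by (auto simp: is_self_affine_measure_def prob_space.finite_measure)
    ultimately show ?thesis unfolding power_decay_measures_def \<mu>_def by simp
  qed
  show ?thesis
  proof (intro exI[of _ \<alpha>] conjI bexI[of _ ?E] allI impI)
    show "?E \<in> null_sets lebesgue" using null by (rule null_sets_completionI)
  qed (fact \<alpha>, rule decay)
qed

end
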